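(* Let $p$ be a prime, let $K$ be either $\mathbb{Z}$, or the localization $\mathbb{Z}_{(p)}$ of $\mathbb{Z}$ at $p$, or the ring $\mathbb{Z}_p$ of $p$-adic integers, let $F$ be a field containing $K$, and let $G\cong C_p\times C_p$ be the direct product of two cyclic groups of order $p$. Then the $K$-dimensions of the indecomposable torsionfree groups $\mathfrak{Crys}(G;M;T)$ are unbounded; that is, for every natural number $N$ there is an indecomposable torsionfree group $\mathfrak{Crys}(G;M;T)$ of $K$-dimension greater than $N$.
   Context: Let $K$ be a principal ideal domain, $F$ a field containing $K$, $G$ a finite group, and $M$ a $KG$-module which is free of finite rank as a $K$-module and on which $G$ acts faithfully. Let $FM$ be the $F$-vector space spanned by a $K$-basis of $M$ (that is, $FM=F\otimes_K M\supseteq M$), with the induced $F$-linear action of $G$, and let $\widehat{M}=FM/M$ be the quotient of additive groups, with action $g(x+M)=g(x)+M$. A $1$-cocycle is a map $T:G\to\widehat{M}$ with $T(gh)=gT(h)+T(g)$ for all $g,h\in G$; it is a coboundary (cohomologous to $0$) if there is $z\in\widehat{M}$ with $T(g)=(g-1)z$ for all $g\in G$. Regarding each value $T(g)$ (a coset of $M$) as a subset of $FM$, define the group $$\mathfrak{Crys}(G;M;T)=\{(g,x)\mid g\in G,\ x\in T(g)\},\qquad (g,x)(g',x')=(gg',\,gx'+x).$$ The $K$-dimension of $\mathfrak{Crys}(G;M;T)$ is the $K$-rank of $M$. When $T$ is not cohomologous to $0$, the group $\mathfrak{Crys}(G;M;T)$ is called indecomposable if $M$ is an indecomposable $KG$-module.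 Torsionfree means that the group has no nontrivial element of finite order. *)

theory Defs
  imports
    "HOL-Algebra.Algebra"
    "HOL-Algebra.Algebraic_Closure_Type"
    "HOL-Library.Function_Algebras"
begin

section \<open>Coefficient rings\<close>

text \<open>The rational numbers whose denominator is prime to \<open>p\<close>; the condition on \<open>b\<close> includes
  \<open>b \<noteq> 0\<close>.\<close>

definition localized_int_ring :: "nat \<Rightarrow> rat ring" where
  "localized_int_ring p =
     ring_of_type_algebra\<lparr>carrier := {of_int a / of_int b | a b. \<not> int p dvd b}\<rparr>"

text \<open>The \<open>p\<close>-adic integers as the inverse limit of the rings of integers modulo \<open>p ^ n\<close>,
  residue classes being represented by their least nonnegative elements.\<close>

definition padic_int_ring :: "nat \<Rightarrow> (nat \<Rightarrow> int) ring" where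
  "padic_int_ring p = \<lparr>
     carrier = {a. \<forall>n. a n \<in> {0..<int p ^ n} \<and> a (Suc n) mod int p ^ n = a n},
     monoid.mult = (\<lambda>a b n. (a n * b n) mod int p ^ n),
     one = (\<lambda>n. 1 mod int p ^ n),
     ring.zero = (\<lambda>n. 0),
     add = (\<lambda>a b n. (a n + b n) mod int p ^ n)\<rparr>"

text \<open>The ring structure that a subset \<open>K\<close> of a field (the whole type \<open>'f\<close>) inherits.\<close>

abbreviation induced_ring :: "'f::field set \<Rightarrow> 'f ring" where
  "induced_ring K \<equiv> ring_of_type_algebra\<lparr>carrier := K\<rparr>"


section \<open>Lattices and their groups of operators\<close>

text \<open>Throughout, the field \<open>F\<close> is the type \<open>'f\<close>, and \<open>K\<close> is a subring of it. A free \<open>K\<close>-module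
  \<open>M\<close> of finite rank is given inside an \<open>F\<close>-vector space in such a way that a \<open>K\<close>-basis of \<open>M\<close> is
  linearly independent over \<open>F\<close>; then the \<open>F\<close>-span of \<open>M\<close> is the extension of scalars \<open>FM\<close>.\<close>

definition lattice_basis ::
  "('f::field \<Rightarrow> 'v::ab_group_add \<Rightarrow> 'v) \<Rightarrow> 'f set \<Rightarrow> 'v set \<Rightarrow> 'v set \<Rightarrow> bool" where
  "lattice_basis scale K M B \<longleftrightarrow>
     finite B \<and> \<not> module.dependent scale B \<and>
     M = {\<Sum>b\<in>B. scale (c b) b | c. c \<in> B \<rightarrow> K}"

text \<open>The choice is immaterial: any two lattice bases are \<open>F\<close>-bases of the same space.\<close>

definition lattice_rank ::
  "('f::field \<Rightarrow> 'v::ab_group_add \<Rightarrow> 'v) \<Rightarrow> 'f set \<Rightarrow> 'v set \<Rightarrow> nat" where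
  "lattice_rank scale K M = card (SOME B. lattice_basis scale K M B)"

abbreviation scalar_ext ::
  "('f::field \<Rightarrow> 'v::ab_group_add \<Rightarrow> 'v) \<Rightarrow> 'v set \<Rightarrow> 'v set" where
  "scalar_ext scale M \<equiv> module.span scale M"

text \<open>\<open>\<rho> g\<close> is the operator of \<open>g\<close> on \<open>FM\<close>; its restriction to \<open>M\<close> is the \<open>KG\<close>-module structure
  of \<open>M\<close>, and conversely it is the only \<open>F\<close>-linear extension of that restriction.\<close>

locale faithful_lattice =
  Vector_Spaces.vector_space scale + group G
  for scale :: "'f::field \<Rightarrow> 'v::ab_group_add \<Rightarrow> 'v"
    and K :: "'f set"
    and G :: "('g, 'b) monoid_scheme" (structure)
    and M :: "'v set"
    and \<rho> :: "'g \<Rightarrow> 'v \<Rightarrow> 'v" +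
  assumes coefficients: "subring K ring_of_type_algebra"
    and finite_group: "finite (carrier G)"
    and free: "\<exists>B. lattice_basis scale K M B"
    and action_on_lattice: "faithful_action G M (\<lambda>g. restrict (\<rho> g) M)"
    and action_on_scalar_ext: "group_action G (scalar_ext scale M) \<rho>"
    and additive: "\<lbrakk>g \<in> carrier G; x \<in> scalar_ext scale M; y \<in> scalar_ext scale M\<rbrakk>
      \<Longrightarrow> \<rho> g (x + y) = \<rho> g x + \<rho> g y"
    and homogeneous: "\<lbrakk>g \<in> carrier G; x \<in> scalar_ext scale M\<rbrakk>
      \<Longrightarrow> \<rho> g (scale c x) = scale c (\<rho> g x)"

definition additive_group :: "'v::ab_group_add set \<Rightarrow> 'v monoid" where
  "additive_group V = \<lparr>carrier = V, monoid.mult = (+), one = 0\<rparr>"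

definition kg_submodule ::
  "('f::field \<Rightarrow> 'v::ab_group_add \<Rightarrow> 'v) \<Rightarrow> 'f set \<Rightarrow> ('g, 'b) monoid_scheme \<Rightarrow> 'v set \<Rightarrow>
   ('g \<Rightarrow> 'v \<Rightarrow> 'v) \<Rightarrow> 'v set \<Rightarrow> bool" where
  "kg_submodule scale K G M \<rho> U \<longleftrightarrow>
     subgroup U (additive_group M) \<and>
     (\<forall>c\<in>K. \<forall>u\<in>U. scale c u \<in> U) \<and>
     (\<forall>g\<in>carrier G. \<forall>u\<in>U. \<rho> g u \<in> U)"

definition indecomposable_lattice ::
  "('f::field \<Rightarrow> 'v::ab_group_add \<Rightarrow> 'v) \<Rightarrow> 'f set \<Rightarrow> ('g, 'b) monoid_scheme \<Rightarrow> 'v set \<Rightarrow>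
   ('g \<Rightarrow> 'v \<Rightarrow> 'v) \<Rightarrow> bool" where
  "indecomposable_lattice scale K G M \<rho> \<longleftrightarrow>
     M \<noteq> {0} \<and>
     (\<forall>U W. kg_submodule scale K G M \<rho> U \<and> kg_submodule scale K G M \<rho> W \<and>
            U \<inter> W = {0} \<and> U <#>\<^bsub>additive_group M\<^esub> W = M
        \<longrightarrow> U = {0} \<or> W = {0})"


section \<open>Cocycles\<close>

text \<open>The elements of this group are the cosets of \<open>M\<close> in \<open>FM\<close>, its multiplication is the addition
  of cosets. Since \<open>\<rho> g\<close> maps \<open>M\<close> onto \<open>M\<close>, the coset of \<open>\<rho> g x\<close> is the image
  under \<open>\<rho> g\<close> of the coset of \<open>x\<close>.\<close>

definition scalar_ext_mod ::
  "('f::field \<Rightarrow> 'v::ab_group_add \<Rightarrow> 'v) \<Rightarrow> 'v set \<Rightarrow> 'v set monoid" where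
  "scalar_ext_mod scale M = additive_group (scalar_ext scale M) Mod M"

definition one_cocycle ::
  "('f::field \<Rightarrow> 'v::ab_group_add \<Rightarrow> 'v) \<Rightarrow> ('g, 'b) monoid_scheme \<Rightarrow> 'v set \<Rightarrow>
   ('g \<Rightarrow> 'v \<Rightarrow> 'v) \<Rightarrow> ('g \<Rightarrow> 'v set) \<Rightarrow> bool" where
  "one_cocycle scale G M \<rho> T \<longleftrightarrow>
     T \<in> carrier G \<rightarrow> carrier (scalar_ext_mod scale M) \<and>
     (\<forall>g\<in>carrier G. \<forall>h\<in>carrier G.
        T (g \<otimes>\<^bsub>G\<^esub> h) = (\<rho> g ` T h) \<otimes>\<^bsub>scalar_ext_mod scale M\<^esub> T g)"

definition one_coboundary ::
  "('f::field \<Rightarrow> 'v::ab_group_add \<Rightarrow> 'v) \<Rightarrow> ('g, 'b) monoid_scheme \<Rightarrow> 'v set \<Rightarrow>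
   ('g \<Rightarrow> 'v \<Rightarrow> 'v) \<Rightarrow> ('g \<Rightarrow> 'v set) \<Rightarrow> bool" where
  "one_coboundary scale G M \<rho> T \<longleftrightarrow>
     (\<exists>z\<in>carrier (scalar_ext_mod scale M). \<forall>g\<in>carrier G.
        T g = (\<rho> g ` z) \<otimes>\<^bsub>scalar_ext_mod scale M\<^esub> inv\<^bsub>scalar_ext_mod scale M\<^esub> z)"


section \<open>Crystallographic groups\<close>

definition Crys ::
  "('g, 'b) monoid_scheme \<Rightarrow> ('g \<Rightarrow> 'v::ab_group_add \<Rightarrow> 'v) \<Rightarrow> ('g \<Rightarrow> 'v set) \<Rightarrow>
   ('g \<times> 'v) monoid" where
  "Crys G \<rho> T = \<lparr>
     carrier = {(g, x). g \<in> carrier G \<and> x \<in> T g},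
     monoid.mult = (\<lambda>(g, x) (g', x'). (g \<otimes>\<^bsub>G\<^esub> g', \<rho> g x' + x)),
     one = (\<one>\<^bsub>G\<^esub>, 0)\<rparr>"

definition torsionfree :: "('a, 'b) monoid_scheme \<Rightarrow> bool" where
  "torsionfree H \<longleftrightarrow>
     (\<forall>x\<in>carrier H. \<forall>n::nat. n > 0 \<and> x [^]\<^bsub>H\<^esub> n = \<one>\<^bsub>H\<^esub> \<longrightarrow> x = \<one>\<^bsub>H\<^esub>)"

definition indecomposable_crys ::
  "('f::field \<Rightarrow> 'v::ab_group_add \<Rightarrow> 'v) \<Rightarrow> 'f set \<Rightarrow> ('g, 'b) monoid_scheme \<Rightarrow> 'v set \<Rightarrow>
   ('g \<Rightarrow> 'v \<Rightarrow> 'v) \<Rightarrow> ('g \<Rightarrow> 'v set) \<Rightarrow> bool" where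
  "indecomposable_crys scale K G M \<rho> T \<longleftrightarrow>
     \<not> one_coboundary scale G M \<rho> T \<and> indecomposable_lattice scale K G M \<rho>"

text \<open>Every finite-dimensional \<open>F\<close>-vector space embeds into the space of sequences in \<open>F\<close>, so that
  lattices of all ranks are found, up to isomorphism, in this one space.\<close>

definition seq_scale :: "'f::field \<Rightarrow> (nat \<Rightarrow> 'f) \<Rightarrow> (nat \<Rightarrow> 'f)" where
  "seq_scale c v = (\<lambda>i. c * v i)"

lemma vector_space_seq_scale: "Vector_Spaces.vector_space seq_scale"
  by unfold_locales (auto simp: seq_scale_def fun_eq_iff algebra_simps)

end

theory Submission
  imports Defs
begin

text \<open>
  The lattice is glued from pieces on which \<open>G\<close> acts through its quotients of order \<open>p\<close>. The group has
  \<open>p + 1\<close> subgroups of order \<open>p\<close>, the kernels of characters \<open>\<chi> 0, \<dots>, \<chi> p\<close>. For each of them take \<open>n\<close> copies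
  of the lattice of functions with sum zero on the integers modulo \<open>p\<close>, shifted by the
  character; besides take \<open>n + 1\<close> copies of \<open>K\<close> with trivial action. Each of these small lattices has a residue
  in \<open>K/pK\<close>, invariant under \<open>G\<close>. The lattice \<open>lat\<close> consists of all tuples whose residues
  are of the form \<open>f\<close> (component \<open>p\<close>), \<open>f - g\<close> (component \<open>1\<close>), \<open>g\<close> (the other nontrivial characters) and
  \<open>X * f - g\<close> (trivial component), where \<open>f\<close> and \<open>g\<close> are polynomials of degree less than \<open>n\<close> over \<open>K/pK\<close>.
  Its rank exceeds \<open>n\<close>.

  Let \<open>lat\<close> be the direct sum of \<open>U\<close> and \<open>W\<close>. Elements of the group ring separate the components
  (\<open>component_isolation\<close>), so each component decomposes as well, and the projection to \<open>U\<close> acts on the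
  pairs \<open>(f, g)\<close> modulo \<open>p\<close>. It preserves the four subspaces \<open>f = 0\<close>, \<open>f = g\<close>, \<open>g = 0\<close>, \<open>X * f = g\<close>, and these
  admit only scalar endomorphisms (\<open>residue_U_scalar\<close>). Being idempotent, the scalar is \<open>0\<close> or \<open>1\<close> modulo \<open>p\<close>, so that
  all residues of \<open>U\<close> or all residues of \<open>W\<close> vanish. A summand without residues is zero by an argument in the style of
  Nakayama's lemma (\<open>summand_trivial_of_residue\<close>). Hence \<open>lat\<close> is indecomposable.

  The cocycle maps \<open>g\<close> to the coset of \<open>\<alpha> g + \<beta> g * (X^n - X)\<close> in the trivial component, where \<open>(\<alpha> g, \<beta> g)\<close>
  are the coordinates of \<open>g\<close>. An element \<open>(g, z)\<close> of finite order has \<open>z = 0\<close> in the trivial component and in the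
  component of any \<open>\<chi> c\<close> that vanishes at \<open>g\<close>. The latter means that \<open>f = 0\<close>, \<open>f = g\<close> or \<open>g = 0\<close>. Then \<open>X * f - g\<close>
  has no term of degree \<open>n\<close>, vanishes at \<open>1\<close>, or has no constant term, and a comparison with the
  cocycle yields that \<open>g\<close> is the identity (\<open>translation_not_fixed\<close>). The same argument shows that the cocycle is not a coboundary.

  About \<open>K\<close> one needs only that it has characteristic \<open>0\<close> and that \<open>p\<close> generates a proper maximal ideal whose powers
  intersect in \<open>0\<close> (\<open>p_local_domain\<close>).
\<close>


section \<open>Arithmetic of the coefficient ring at \<open>p\<close>\<close>

text \<open>The construction uses only the following facts about \<open>K\<close>: it has characteristic \<open>0\<close>, \<open>p\<close>
  generates a proper maximal ideal, and no nonzero element is divisible by all powers of \<open>p\<close>.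
  They are stated for \<open>K\<close> itself, so that the three cases are treated at once.\<close>

locale p_local_domain =
  fixes p :: nat and K :: "'f::field set"
  assumes prime_p: "Factorial_Ring.prime p"
    and K_0: "0 \<in> K" and K_1: "1 \<in> K"
    and K_minus: "x \<in> K \<Longrightarrow> - x \<in> K"
    and K_add: "x \<in> K \<Longrightarrow> y \<in> K \<Longrightarrow> x + y \<in> K"
    and K_mult: "x \<in> K \<Longrightarrow> y \<in> K \<Longrightarrow> x * y \<in> K"
    and char_0: "of_nat m = (0::'f) \<Longrightarrow> m = 0"
    and p_maximal: "x \<in> K \<Longrightarrow> (\<exists>y\<in>K. x = of_nat p * y) \<or> (\<exists>y\<in>K. \<exists>z\<in>K. x * y = 1 + of_nat p * z)"
    and p_separated: "x \<in> K \<Longrightarrow> (\<And>k. \<exists>y\<in>K. x = of_nat (p ^ k) * y) \<Longrightarrow> x = 0"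
    and p_nonunit: "y \<in> K \<Longrightarrow> of_nat p * y \<noteq> 1"

text \<open>Each condition speaks of the ring operations and of the multiples of \<open>1\<close> only, hence may be checked
  in an isomorphic ring; \<open>e m\<close> is the \<open>m\<close>-fold sum of the identity there.\<close>

lemma p_local_domain_of_iso:
  fixes K :: "'f::field set" and R :: "'r ring" and e :: "nat \<Rightarrow> 'r"
  assumes p: "Factorial_Ring.prime p"
    and K: "subring K ring_of_type_algebra"
    and iso: "induced_ring K \<simeq> R"
    and zero_unique: "\<And>x. x \<in> carrier R \<Longrightarrow> x \<oplus>\<^bsub>R\<^esub> x = x \<Longrightarrow> x = e 0"
    and e_Suc: "\<And>m. e (Suc m) = e m \<oplus>\<^bsub>R\<^esub> \<one>\<^bsub>R\<^esub>"
    and e_inj: "\<And>m. e m = e 0 \<Longrightarrow> m = 0"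
    and maximal: "\<And>x. x \<in> carrier R \<Longrightarrow>
      (\<exists>y\<in>carrier R. x = e p \<otimes>\<^bsub>R\<^esub> y) \<or>
      (\<exists>y\<in>carrier R. \<exists>z\<in>carrier R. x \<otimes>\<^bsub>R\<^esub> y = \<one>\<^bsub>R\<^esub> \<oplus>\<^bsub>R\<^esub> e p \<otimes>\<^bsub>R\<^esub> z)"
    and separated: "\<And>x. x \<in> carrier R \<Longrightarrow> (\<And>k. \<exists>y\<in>carrier R. x = e (p ^ k) \<otimes>\<^bsub>R\<^esub> y) \<Longrightarrow> x = e 0"
    and nonunit: "\<And>y. y \<in> carrier R \<Longrightarrow> e p \<otimes>\<^bsub>R\<^esub> y \<noteq> \<one>\<^bsub>R\<^esub>"
  shows "p_local_domain p K"
proof -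
  obtain h where h: "h \<in> ring_iso (induced_ring K) R"
    using iso by (auto simp: is_ring_iso_def)
  have h_mult: "h (x * y) = h x \<otimes>\<^bsub>R\<^esub> h y" and h_add: "h (x + y) = h x \<oplus>\<^bsub>R\<^esub> h y"
    if "x \<in> K" "y \<in> K" for x y
    using ring_iso_memE[OF h] that by (simp_all add: ring_of_type_algebra_def)
  have h_1: "h 1 = \<one>\<^bsub>R\<^esub>" and bij: "bij_betw h K (carrier R)"
    using ring_iso_memE[OF h] by (simp_all add: ring_of_type_algebra_def)
  interpret subring K ring_of_type_algebra by fact
  have add_group: "ring (ring_of_type_algebra :: 'f ring)" ..
  have K_1: "1 \<in> K" and K_mult: "\<And>x y. x \<in> K \<Longrightarrow> y \<in> K \<Longrightarrow> x * y \<in> K"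
    and K_add: "\<And>x y. x \<in> K \<Longrightarrow> y \<in> K \<Longrightarrow> x + y \<in> K" and K_0: "0 \<in> K"
    using one_closed m_closed subringE(2,7)[OF K] by (auto simp: ring_of_type_algebra_def)
  have K_minus: "- x \<in> K" if "x \<in> K" for x
  proof -
    have "\<ominus>\<^bsub>ring_of_type_algebra\<^esub> x \<in> K"
      using subringE(5)[OF K that] .
    moreover have "\<ominus>\<^bsub>ring_of_type_algebra\<^esub> x = - x"
      using abelian_group.minus_equality[OF ring.is_abelian_group[OF add_group], of "- x" x]
      by (simp add: ring_of_type_algebra_def)
    ultimately show ?thesis by simp
  qed
  have eq_iff: "h x = h y \<longleftrightarrow> x = y" if "x \<in> K" "y \<in> K" for x y
    using bij that by (auto simp: bij_betw_def inj_on_def)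
  have h_in: "h x \<in> carrier R" if "x \<in> K" for x
    using bij that by (auto simp: bij_betw_def)
  have onto: "\<exists>x\<in>K. h x = z" if "z \<in> carrier R" for z
    using bij that by (metis bij_betw_imp_surj_on imageE)
  have nat_K: "of_nat m \<in> K" for m :: nat
    by (induction m) (auto simp: K_0 K_1 K_add)
  have h_nat: "h (of_nat m) = e m" for m
  proof (induction m)
    case 0
    have "h 0 \<oplus>\<^bsub>R\<^esub> h 0 = h 0" using h_add[OF K_0 K_0] by simp
    then show ?case using zero_unique[OF h_in[OF K_0]] by simp
  next
    case (Suc m)
    have "h (of_nat (Suc m)) = h (of_nat m + 1)" by (simp add: add.commute)
    then show ?case using Suc e_Suc h_1 h_add[OF nat_K K_1] by simp
  qed
  show ?thesis
  proof
    show "m = 0" if "of_nat m = (0::'f)" for m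
      using that e_inj[of m] h_nat[of m] h_nat[of 0] by simp
    show "(\<exists>y\<in>K. x = of_nat p * y) \<or> (\<exists>y\<in>K. \<exists>z\<in>K. x * y = 1 + of_nat p * z)" if x: "x \<in> K" for x
      using maximal[OF h_in[OF x]]
    proof (elim disjE bexE)
      fix y assume y: "y \<in> carrier R" and *: "h x = e p \<otimes>\<^bsub>R\<^esub> y"
      then obtain y' where y': "y' \<in> K" "h y' = y" using onto by blast
      have "h x = h (of_nat p * y')" unfolding h_mult[OF nat_K[of p] y'(1)] h_nat[of p] y'(2) using * .
      then have "x = of_nat p * y'" using eq_iff[OF x K_mult[OF nat_K y'(1)]] by simp
      then show ?thesis using y'(1) by blast
    next
      fix y z assume y: "y \<in> carrier R" and z: "z \<in> carrier R"
        and *: "h x \<otimes>\<^bsub>R\<^esub> y = \<one>\<^bsub>R\<^esub> \<oplus>\<^bsub>R\<^esub> e p \<otimes>\<^bsub>R\<^esub> z"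
      then obtain y' z' where y': "y' \<in> K" "h y' = y" and z': "z' \<in> K" "h z' = z"
        using onto by blast
      have "h (x * y') = h (1 + of_nat p * z')"
        unfolding h_mult[OF x y'(1)] h_add[OF K_1 K_mult[OF nat_K[of p] z'(1)]]
          h_mult[OF nat_K[of p] z'(1)] h_nat[of p] h_1 y'(2) z'(2) using * .
      then have "x * y' = 1 + of_nat p * z'"
        using eq_iff[OF K_mult[OF x y'(1)] K_add[OF K_1 K_mult[OF nat_K z'(1)]]] by simp
      then show ?thesis using y'(1) z'(1) by blast
    qed
    show "x = 0" if x: "x \<in> K" and div: "\<And>k. \<exists>y\<in>K. x = of_nat (p ^ k) * y" for x
    proof -
      have "\<exists>y\<in>carrier R. h x = e (p ^ k) \<otimes>\<^bsub>R\<^esub> y" for k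
        using div[of k] h_mult[OF nat_K[of "p ^ k"]] h_nat[of "p ^ k"] h_in by metis
      then have "h x = h 0" using separated[OF h_in[OF x]] h_nat[of 0] by simp
      then show ?thesis using eq_iff[OF x K_0] by simp
    qed
    show "of_nat p * y \<noteq> 1" if y: "y \<in> K" for y
      using nonunit[OF h_in[OF y]] h_mult[OF nat_K[of p] y] h_nat[of p] h_1 by metis
  qed (use p K_0 K_1 K_add K_mult K_minus in auto)
qed

lemma prime_inverse_mod:
  assumes p: "Factorial_Ring.prime (p::nat)" and "\<not> int p dvd a"
  obtains b c where "a * b = 1 + int p * c"
proof -
  have "coprime a (int p)"
    using assms by (metis coprime_commute prime_imp_coprime prime_nat_int_transfer)
  then obtain u v where "u * a + v * int p = 1"
    using bezout_int[of a "int p"] by auto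
  then have "a * u = 1 + int p * (- v)" by (simp add: algebra_simps)
  then show ?thesis using that by blast
qed

lemma dvd_all_powers_imp_zero:
  assumes p: "Factorial_Ring.prime (p::nat)" and "\<And>k. int p ^ k dvd a"
  shows "a = 0"
proof (rule ccontr)
  assume "a \<noteq> 0"
  have "nat \<bar>a\<bar> < p ^ nat \<bar>a\<bar>"
    using prime_gt_1_nat[OF p] by (simp add: power_gt_expt)
  then have "\<bar>a\<bar> < int p ^ nat \<bar>a\<bar>"
    using of_nat_less_iff[where ?'a = int, of "nat \<bar>a\<bar>" "p ^ nat \<bar>a\<bar>"] by simp
  moreover have "int p ^ nat \<bar>a\<bar> \<le> \<bar>a\<bar>"
    using dvd_imp_le_int[OF \<open>a \<noteq> 0\<close> assms(2)[of "nat \<bar>a\<bar>"]] by simp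
  ultimately show False by simp
qed

lemma p_local_domain_integers:
  assumes p: "Factorial_Ring.prime p" and K: "subring K ring_of_type_algebra"
    and iso: "induced_ring K \<simeq> \<Z>"
  shows "p_local_domain p K"
proof (rule p_local_domain_of_iso[OF p K iso, of int])
  fix x :: int
  show "(\<exists>y\<in>carrier \<Z>. x = int p \<otimes>\<^bsub>\<Z>\<^esub> y) \<or>
      (\<exists>y\<in>carrier \<Z>. \<exists>z\<in>carrier \<Z>. x \<otimes>\<^bsub>\<Z>\<^esub> y = \<one>\<^bsub>\<Z>\<^esub> \<oplus>\<^bsub>\<Z>\<^esub> int p \<otimes>\<^bsub>\<Z>\<^esub> z)"
    proof (cases "int p dvd x")
    case False
    then obtain b c where "x * b = 1 + int p * c" using prime_inverse_mod[OF p] by blast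
    then show ?thesis by auto
  qed auto
  show "x = int 0" if "\<And>k. \<exists>y\<in>carrier \<Z>. x = int (p ^ k) \<otimes>\<^bsub>\<Z>\<^esub> y"
    using dvd_all_powers_imp_zero[OF p, of x] that by (simp add: dvd_def)
  show "int p \<otimes>\<^bsub>\<Z>\<^esub> x \<noteq> \<one>\<^bsub>\<Z>\<^esub>"
    using prime_gt_1_nat[OF p] by (auto simp: zmult_eq_1_iff)
qed auto

lemma p_local_domain_localization:
  assumes p: "Factorial_Ring.prime p" and K: "subring K ring_of_type_algebra"
    and iso: "induced_ring K \<simeq> localized_int_ring p"
  shows "p_local_domain p K"
proof (rule p_local_domain_of_iso[OF p K iso, of of_nat])
  let ?R = "localized_int_ring p"
  have p1: "\<not> int p dvd 1"
    using prime_gt_1_nat[OF p] by auto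
  have mem: "of_int a / of_int b \<in> carrier ?R" if "\<not> int p dvd b" for a b
    using that by (auto simp: localized_int_ring_def)
  have mem_int: "of_int a \<in> carrier ?R" for a
    using mem[OF p1, of a] by simp
  have ops: "x \<otimes>\<^bsub>?R\<^esub> y = x * y" "x \<oplus>\<^bsub>?R\<^esub> y = x + y" "\<one>\<^bsub>?R\<^esub> = 1" for x y
    by (simp_all add: localized_int_ring_def ring_of_type_algebra_def)
  fix x assume "x \<in> carrier ?R"
  then obtain a b where x: "x = of_int a / of_int b" and b: "\<not> int p dvd b"
    by (auto simp: localized_int_ring_def)
  have b0: "b \<noteq> 0" using b by auto
  show "(\<exists>y\<in>carrier ?R. x = of_nat p \<otimes>\<^bsub>?R\<^esub> y) \<or>
      (\<exists>y\<in>carrier ?R. \<exists>z\<in>carrier ?R. x \<otimes>\<^bsub>?R\<^esub> y = \<one>\<^bsub>?R\<^esub> \<oplus>\<^bsub>?R\<^esub> of_nat p \<otimes>\<^bsub>?R\<^esub> z)"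
  proof (cases "int p dvd a")
    case True
    then obtain a' where "a = int p * a'" by blast
    then have "x = of_nat p * (of_int a' / of_int b)" using x by simp
    then show ?thesis using mem[OF b, of a'] unfolding ops by blast
  next
    case False
    then obtain c d where "a * c = 1 + int p * d" using prime_inverse_mod[OF p] by blast
    then have "(of_int (a * c) :: rat) = of_int (1 + int p * d)" by simp
    then have "x * of_int (b * c) = 1 + of_nat p * of_int d" using x b0 by simp
    then show ?thesis using mem_int[of "b * c"] mem_int[of d] unfolding ops by blast
  qed
  show "x = of_nat 0" if div: "\<And>k. \<exists>y\<in>carrier ?R. x = of_nat (p ^ k) \<otimes>\<^bsub>?R\<^esub> y"
  proof -
    have "int p ^ k dvd a" for k
    proof -
      obtain y where "y \<in> carrier ?R" and xy: "x = of_nat (p ^ k) * y"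
        using div[of k] by (auto simp: ops)
      then obtain c d where y: "y = of_int c / of_int d" and d: "\<not> int p dvd d"
        by (auto simp: localized_int_ring_def)
      have "d \<noteq> 0" using d by auto
      with xy x y b0 have "(of_int (a * d) :: rat) = of_int (int p ^ k * (b * c))"
        by (simp add: field_simps)
      then have "a * d = int p ^ k * (b * c)" by (simp only: of_int_eq_iff)
      then have "int p ^ k dvd a * d" by simp
      moreover have "coprime (int p ^ k) d"
        using d p by (metis coprime_power_left_iff prime_imp_coprime prime_nat_int_transfer)
      ultimately show ?thesis by (simp add: coprime_dvd_mult_left_iff)
    qed
    then show ?thesis using dvd_all_powers_imp_zero[OF p] x by simp
  qed
  show "of_nat p \<otimes>\<^bsub>?R\<^esub> x \<noteq> \<one>\<^bsub>?R\<^esub>"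
  proof
    assume "of_nat p \<otimes>\<^bsub>?R\<^esub> x = \<one>\<^bsub>?R\<^esub>"
    then have "(of_int (int p * a) :: rat) = of_int b" using x b0 by (simp add: ops field_simps)
    then have "int p * a = b" by (simp only: of_int_eq_iff)
    then show False using b by auto
  qed
qed (auto simp: localized_int_ring_def ring_of_type_algebra_def)

lemma p_local_domain_padic:
  assumes p: "Factorial_Ring.prime p" and K: "subring K ring_of_type_algebra"
    and iso: "induced_ring K \<simeq> padic_int_ring p"
  shows "p_local_domain p K"
proof (rule p_local_domain_of_iso[OF p K iso, of "\<lambda>m n. int m mod int p ^ n"])
  let ?R = "padic_int_ring p" and ?e = "\<lambda>m n. int m mod int p ^ n"
  have p_pos: "int p ^ n > 0" for n using prime_gt_0_nat[OF p] by simp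
  have memI: "(\<lambda>n. f n mod int p ^ n) \<in> carrier ?R"
    if "\<And>n. f (Suc n) mod int p ^ n = f n mod int p ^ n" for f
    using that p_pos by (auto simp: padic_int_ring_def mod_mod_cancel le_imp_power_dvd)
  have mem_reduce: "x n mod int p ^ n = x n" "0 \<le> x n" "x n < int p ^ n"
    "x (Suc n) mod int p ^ n = x n" if "x \<in> carrier ?R" for x n
    using that by (auto simp: padic_int_ring_def)
  have ops: "x \<otimes>\<^bsub>?R\<^esub> y = (\<lambda>n. (x n * y n) mod int p ^ n)"
    "x \<oplus>\<^bsub>?R\<^esub> y = (\<lambda>n. (x n + y n) mod int p ^ n)" "\<one>\<^bsub>?R\<^esub> = (\<lambda>n. 1 mod int p ^ n)" for x y
    by (simp_all add: padic_int_ring_def)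
  show "?e (Suc m) = ?e m \<oplus>\<^bsub>?R\<^esub> \<one>\<^bsub>?R\<^esub>" for m
    by (simp add: ops mod_simps add.commute)
  show "m = 0" if "?e m = ?e 0" for m
    using dvd_all_powers_imp_zero[OF p, of "int m"] fun_cong[OF that]
    by (simp add: dvd_eq_mod_eq_0)
  fix x assume x: "x \<in> carrier ?R"
  show "x = ?e 0" if "x \<oplus>\<^bsub>?R\<^esub> x = x"
  proof
    fix n
    have "(x n + x n) mod int p ^ n = x n" using fun_cong[OF that, of n] by (simp add: ops)
    then have "(x n + x n) mod int p ^ n = x n mod int p ^ n" using mem_reduce(1)[OF x] by simp
    then have "int p ^ n dvd x n" by (simp add: mod_eq_dvd_iff)
    then show "x n = ?e 0 n" using mem_reduce(1)[OF x, of n] by (simp add: dvd_eq_mod_eq_0)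
  qed
  \<comment> \<open>An element whose residue modulo \<open>p\<close> vanishes is \<open>p\<close> times its shifted and divided sequence.\<close>
  have divide_p: "\<exists>z\<in>carrier ?R. \<forall>n. (int p * z n) mod int p ^ n = f n mod int p ^ n"
    if f: "\<And>n. f (Suc n) mod int p ^ n = f n mod int p ^ n" and f1: "int p dvd f 1" for f
  proof
    have fd: "int p dvd f (Suc n)" for n
    proof (induction n)
      case (Suc n)
      have "int p ^ Suc n dvd f (Suc (Suc n)) - f (Suc n)"
        using f[of "Suc n"] by (simp add: mod_eq_dvd_iff)
      then have "int p dvd f (Suc (Suc n)) - f (Suc n)"
        using dvd_trans[of "int p" "int p ^ Suc n"] by simp
      then show ?case using Suc by (metis dvd_add diff_add_cancel)
    qed (use f1 in simp)
    have fp: "int p * (f (Suc n) div int p) = f (Suc n)" for n using fd by simp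
    let ?z = "\<lambda>n. (f (Suc n) div int p) mod int p ^ n"
    show "?z \<in> carrier ?R"
    proof (rule memI)
      fix n
      have "int p ^ Suc n dvd f (Suc (Suc n)) - f (Suc n)"
        using f[of "Suc n"] by (simp add: mod_eq_dvd_iff)
      then have "int p * int p ^ n dvd int p * (f (Suc (Suc n)) div int p - f (Suc n) div int p)"
        by (simp only: fp right_diff_distrib power_Suc)
      then show "(f (Suc (Suc n)) div int p) mod int p ^ n = (f (Suc n) div int p) mod int p ^ n"
        using prime_gt_0_nat[OF p] by (simp add: mod_eq_dvd_iff)
    qed
    show "\<forall>n. (int p * ?z n) mod int p ^ n = f n mod int p ^ n"
      using fp f by (simp add: mod_simps)
  qed
  show "(\<exists>y\<in>carrier ?R. x = ?e p \<otimes>\<^bsub>?R\<^esub> y) \<or>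
      (\<exists>y\<in>carrier ?R. \<exists>z\<in>carrier ?R. x \<otimes>\<^bsub>?R\<^esub> y = \<one>\<^bsub>?R\<^esub> \<oplus>\<^bsub>?R\<^esub> ?e p \<otimes>\<^bsub>?R\<^esub> z)"
  proof (cases "int p dvd x 1")
    case True
    then obtain z where "z \<in> carrier ?R" "\<forall>n. (int p * z n) mod int p ^ n = x n mod int p ^ n"
      using divide_p[of x] mem_reduce[OF x] by auto
    then show ?thesis using mem_reduce(1)[OF x] by (auto simp: ops mod_simps intro!: disjI1 bexI[of _ z])
  next
    case False
    then obtain b c where bc: "x 1 * b = 1 + int p * c" using prime_inverse_mod[OF p] by blast
    have "(x (Suc n) * b - 1) mod int p ^ n = (x n * b - 1) mod int p ^ n" for n
      using mem_reduce(4)[OF x, of n] mod_mult_left_eq mod_diff_left_eq by metis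
    then obtain z where z: "z \<in> carrier ?R"
      and zn: "\<forall>n. (int p * z n) mod int p ^ n = (x n * b - 1) mod int p ^ n"
      using divide_p[of "\<lambda>n. x n * b - 1"] bc by auto
    have "(x n * b) mod int p ^ n = (1 + int p * z n) mod int p ^ n" for n
      using zn[rule_format, of n] by (metis add_diff_cancel_left' diff_add_cancel mod_add_right_eq add.commute)
    then have "x \<otimes>\<^bsub>?R\<^esub> (\<lambda>n. b mod int p ^ n) = \<one>\<^bsub>?R\<^esub> \<oplus>\<^bsub>?R\<^esub> ?e p \<otimes>\<^bsub>?R\<^esub> z"
      by (simp add: ops mod_simps)
    moreover have "(\<lambda>n. b mod int p ^ n) \<in> carrier ?R" by (rule memI) simp
    ultimately show ?thesis using z by blast
  qed
  show "x = ?e 0" if div: "\<And>k. \<exists>y\<in>carrier ?R. x = ?e (p ^ k) \<otimes>\<^bsub>?R\<^esub> y"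
  proof
    fix n
    obtain y where "x = ?e (p ^ n) \<otimes>\<^bsub>?R\<^esub> y" using div by blast
    then show "x n = ?e 0 n" by (simp add: ops)
  qed
  show "?e p \<otimes>\<^bsub>?R\<^esub> x \<noteq> \<one>\<^bsub>?R\<^esub>"
  proof
    assume "?e p \<otimes>\<^bsub>?R\<^esub> x = \<one>\<^bsub>?R\<^esub>"
    from fun_cong[OF this, of 1] show False using prime_gt_1_nat[OF p] by (simp add: ops)
  qed
qed


section \<open>Congruences modulo \<open>p\<close>\<close>

context p_local_domain
begin

text \<open>Working with congruences between elements of \<open>K\<close> replaces linear algebra over the field \<open>K/pK\<close>.\<close>

definition pcong :: "'f \<Rightarrow> 'f \<Rightarrow> bool" (infix "\<approx>\<^sub>p" 50) where
  "a \<approx>\<^sub>p b \<longleftrightarrow> (\<exists>y\<in>K. a - b = of_nat p * y)"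

lemma p_gt_1: "1 < p" and p_gt_0: "0 < p"
  using prime_gt_1_nat[OF prime_p] prime_gt_0_nat[OF prime_p] by auto

lemma K_diff: "x \<in> K \<Longrightarrow> y \<in> K \<Longrightarrow> x - y \<in> K"
  using K_add[of x "- y"] K_minus by simp

lemma K_of_nat: "of_nat m \<in> K"
  by (induction m) (auto simp: K_0 K_1 K_add)

lemma K_sum: "(\<And>i. i \<in> A \<Longrightarrow> f i \<in> K) \<Longrightarrow> sum f A \<in> K"
  by (induction A rule: infinite_finite_induct) (auto simp: K_0 K_add)

lemma p_nonzero: "of_nat p \<noteq> (0::'f)"
  using char_0 p_gt_0 by blast

lemma pcong_refl [simp]: "a \<approx>\<^sub>p a"
  using K_0 by (auto simp: pcong_def)

lemma pcong_add: "a \<approx>\<^sub>p b \<Longrightarrow> c \<approx>\<^sub>p d \<Longrightarrow> a + c \<approx>\<^sub>p b + d"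
proof -
  assume "a \<approx>\<^sub>p b" "c \<approx>\<^sub>p d"
  then obtain y z where "y \<in> K" "z \<in> K" "a - b = of_nat p * y" "c - d = of_nat p * z"
    by (auto simp: pcong_def)
  then have "y + z \<in> K" "(a + c) - (b + d) = of_nat p * (y + z)"
    by (auto simp: K_add algebra_simps)
  then show ?thesis by (auto simp: pcong_def)
qed

lemma pcong_scale: "x \<in> K \<Longrightarrow> a \<approx>\<^sub>p b \<Longrightarrow> x * a \<approx>\<^sub>p x * b"
proof -
  assume x: "x \<in> K" and "a \<approx>\<^sub>p b"
  then obtain y where "y \<in> K" "a - b = of_nat p * y"
    by (auto simp: pcong_def)
  then have "x * y \<in> K" "x * a - x * b = of_nat p * (x * y)"
    using x by (auto simp: K_mult right_diff_distrib[symmetric])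
  then show ?thesis by (auto simp: pcong_def)
qed

lemma pcong_minus: "a \<approx>\<^sub>p b \<Longrightarrow> - a \<approx>\<^sub>p - b"
  using pcong_scale[OF K_minus[OF K_1]] by simp

lemma pcong_diff: "a \<approx>\<^sub>p b \<Longrightarrow> c \<approx>\<^sub>p d \<Longrightarrow> a - c \<approx>\<^sub>p b - d"
  using pcong_add[OF _ pcong_minus] by simp

lemma pcong_sym: "a \<approx>\<^sub>p b \<Longrightarrow> b \<approx>\<^sub>p a"
  using pcong_add[OF pcong_minus[of a b] pcong_refl[of "a + b"]] by (simp add: algebra_simps)

lemma pcong_trans [trans]: "a \<approx>\<^sub>p b \<Longrightarrow> b \<approx>\<^sub>p c \<Longrightarrow> a \<approx>\<^sub>p c"
  using pcong_diff[OF pcong_add[of a b b c] pcong_refl[of b]] by simp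

lemma pcong_sum: "(\<And>i. i \<in> A \<Longrightarrow> f i \<approx>\<^sub>p g i) \<Longrightarrow> sum f A \<approx>\<^sub>p sum g A"
  by (induction A rule: infinite_finite_induct) (auto intro: pcong_add)

lemma pcong_p_mult: "x \<in> K \<Longrightarrow> of_nat p * x \<approx>\<^sub>p 0"
  by (auto simp: pcong_def)

text \<open>The ideal \<open>pK\<close> is maximal, hence prime.\<close>

lemma pcong_0_prime:
  assumes "a \<in> K" "b \<in> K" "a * b \<approx>\<^sub>p 0"
  shows "a \<approx>\<^sub>p 0 \<or> b \<approx>\<^sub>p 0"
  using p_maximal[OF assms(1)]
proof (elim disjE bexE)
  fix y z assume y: "y \<in> K" and z: "z \<in> K" and *: "a * y = 1 + of_nat p * z"
  have "y * (a * b) - of_nat p * (z * b) \<approx>\<^sub>p y * 0 - 0"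
    by (intro pcong_diff pcong_scale pcong_p_mult K_mult y z assms)
  moreover have "y * (a * b) - of_nat p * (z * b) = b"
  proof -
    have "y * (a * b) = (a * y) * b" by simp
    then show ?thesis unfolding * by (simp add: algebra_simps)
  qed
  ultimately show ?thesis by simp
qed (auto simp: pcong_def)

lemma pcong_of_nat_0: "of_nat m \<approx>\<^sub>p 0 \<longleftrightarrow> p dvd m"
proof
  assume "of_nat m \<approx>\<^sub>p 0"
  then have "\<exists>y\<in>K. (of_nat (gcd p m) :: 'f) = of_nat p * y"
  proof -
    obtain u v where uv: "u * int p + v * int m = int (gcd p m)"
      using bezout_int[of "int p" "int m"] by auto
    have K_int: "of_int i \<in> K" for i
      using K_of_nat K_minus[OF K_of_nat] by (cases i) (auto simp del: of_nat_Suc)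
    obtain y where y: "y \<in> K" "of_nat m = of_nat p * y"
      using \<open>of_nat m \<approx>\<^sub>p 0\<close> by (auto simp: pcong_def)
    have "(of_nat (gcd p m) :: 'f) = of_int (u * int p + v * int m)"
      by (simp only: uv of_int_of_nat_eq)
    also have "\<dots> = of_nat p * (of_int u + of_int v * y)"
      using y by (simp add: algebra_simps)
    finally show ?thesis using y K_int by (blast intro: K_add K_mult)
  qed
  then have "gcd p m \<noteq> 1" using p_nonunit by auto
  then show "p dvd m" using prime_p
    by (metis coprime_iff_gcd_eq_1 prime_imp_coprime)
next
  assume "p dvd m"
  then show "of_nat m \<approx>\<^sub>p 0" by (auto simp: pcong_p_mult K_of_nat)
qed

end


section \<open>Lattice bases\<close>

interpretation seq: Vector_Spaces.vector_space seq_scale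
  by (rule vector_space_seq_scale)

lemma seq_scale_apply [simp]: "seq_scale c v j = c * v j"
  by (simp add: seq_scale_def)

lemma sum_fun_apply [simp]: "(sum f A) x = (\<Sum>a\<in>A. f a x)"
  by (induction A rule: infinite_finite_induct) auto

text \<open>Every lattice basis is a basis of the span of the lattice over the field, so that its
  cardinality is the dimension of this span.\<close>

lemma lattice_rank_eq_card:
  assumes "0 \<in> K" "1 \<in> K" and B: "lattice_basis seq_scale K M B"
  shows "lattice_rank seq_scale K M = card B"
proof -
  have span: "seq.dim M = card C" if C: "lattice_basis seq_scale K M C" for C
  proof -
    have fin: "finite C" and ind: "seq.independent C"
      and M: "M = {\<Sum>b\<in>C. seq_scale (c b) b | c. c \<in> C \<rightarrow> K}"
      using C by (auto simp: lattice_basis_def)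
    have "b \<in> M" if b: "b \<in> C" for b
    proof -
      have "(\<Sum>x\<in>C. seq_scale (if x = b then 1 else 0) x) = b"
        using fin b by (simp add: sum.delta if_distrib[of "\<lambda>a. seq_scale a _"] cong: if_cong)
      then show ?thesis unfolding M using assms(1,2) by (auto intro!: exI[of _ "\<lambda>x. if x = b then 1 else 0"])
    qed
    moreover have "M \<subseteq> seq.span C"
      unfolding M using seq.span_sum seq.span_scale seq.span_base by (smt (verit) mem_Collect_eq subsetI)
    ultimately have "seq.dim M = seq.dim C"
      by (intro seq.span_eq_dim) (simp add: seq.span_eq subset_iff seq.span_base)
    then show ?thesis using seq.dim_eq_card_independent[OF ind] by simp
  qed
  show ?thesis unfolding lattice_rank_def
    using span[OF B] span[OF someI[of "lattice_basis seq_scale K M", OF B]] by simp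
qed

text \<open>A sublattice between \<open>p K^J\<close> and \<open>K^J\<close> is free because the elimination of coordinates meets only
  ideals of \<open>K\<close> that contain \<open>p\<close>, and these are principal. The set \<open>J\<close> may be any set of coordinates
  that determines the elements of the lattice.\<close>

lemma (in p_local_domain) lattice_basis_of_coordinates:
  assumes "finite J" and "0 \<in> M"
    and "\<And>v w. v \<in> M \<Longrightarrow> w \<in> M \<Longrightarrow> v + w \<in> M"
    and "\<And>c v. c \<in> K \<Longrightarrow> v \<in> M \<Longrightarrow> seq_scale c v \<in> M"
    and "\<And>v j. v \<in> M \<Longrightarrow> j \<in> J \<Longrightarrow> v j \<in> K"
    and "\<And>v. v \<in> M \<Longrightarrow> (\<And>j. j \<in> J \<Longrightarrow> v j = 0) \<Longrightarrow> v = 0"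
    and "\<And>j. j \<in> J \<Longrightarrow> \<exists>v\<in>M. v j = of_nat p \<and> (\<forall>i\<in>J - {j}. v i = 0)"
  shows "\<exists>B. lattice_basis seq_scale K M B \<and> card B = card J"
  using assms
proof (induction J arbitrary: M rule: finite_induct)
  case empty
  have "v = 0" if "v \<in> M" for v by (rule empty.prems(5)[OF that]) blast
  then have "M = {0}" using empty.prems(1) by blast
  then have "lattice_basis seq_scale K M {}"
    using seq.independent_empty by (simp add: lattice_basis_def)
  moreover have "card ({} :: (nat \<Rightarrow> 'f) set) = card ({} :: nat set)" by simp
  ultimately show ?case by blast
next
  case (insert j J)
  note M0 = insert.prems(1) and M_add = insert.prems(2) and M_scale = insert.prems(3)
    and M_K = insert.prems(4) and M_inj = insert.prems(5) and M_p = insert.prems(6)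
  let ?M' = "{v \<in> M. v j = 0}"
  have "\<exists>B. lattice_basis seq_scale K ?M' B \<and> card B = card J"
  proof (rule insert.IH)
    fix i assume i: "i \<in> J"
    then obtain v where "v \<in> M" "v i = of_nat p" "\<forall>k\<in>insert j J - {i}. v k = 0"
      using M_p[of i] by blast
    then show "\<exists>v\<in>?M'. v i = of_nat p \<and> (\<forall>k\<in>J - {i}. v k = 0)"
      using i insert.hyps by (intro bexI[of _ v]) auto
  next
    fix v assume "v \<in> ?M'" "\<And>i. i \<in> J \<Longrightarrow> v i = 0"
    then show "v = 0" by (intro M_inj) auto
  qed (use M0 M_add M_scale M_K in auto)
  then obtain B where B: "lattice_basis seq_scale K ?M' B" and cardB: "card B = card J" by blast
  have fin: "finite B" and ind: "seq.independent B"
    and M': "?M' = {\<Sum>b\<in>B. seq_scale (c b) b | c. c \<in> B \<rightarrow> K}"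
    using B by (auto simp: lattice_basis_def)
  obtain b where b: "b \<in> M" "b j = of_nat p" using M_p[of j] by blast
  \<comment> \<open>The ideal of all \<open>j\<close>-th entries contains \<open>p\<close>, so it is generated by \<open>1\<close> or by \<open>p\<close>.\<close>
  obtain m where m: "m \<in> M" "m j \<noteq> 0" and gen: "\<And>v. v \<in> M \<Longrightarrow> \<exists>c\<in>K. v j = c * m j"
  proof (cases "\<forall>v\<in>M. \<exists>y\<in>K. v j = of_nat p * y")
    case True
    then show ?thesis using that[of b] b p_nonzero by (metis mult.commute)
  next
    case False
    then obtain v where v: "v \<in> M" "\<not> (\<exists>y\<in>K. v j = of_nat p * y)" by blast
    then obtain y z where yz: "y \<in> K" "z \<in> K" "v j * y = 1 + of_nat p * z"
      using p_maximal[of "v j"] M_K by blast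
    have "(seq_scale y v + seq_scale (- z) b) j = 1"
      using yz b by (simp add: algebra_simps)
    moreover have "seq_scale y v + seq_scale (- z) b \<in> M"
      using v b yz by (intro M_add M_scale K_minus)
    ultimately show ?thesis using that[of "seq_scale y v + seq_scale (- z) b"] M_K by auto
  qed
  have BM: "x \<in> ?M'" if x: "x \<in> B" for x
  proof -
    have "(\<Sum>y\<in>B. seq_scale (if y = x then 1 else 0) y) = x"
      using fin x by (simp add: sum.delta if_distrib[of "\<lambda>a. seq_scale a _"] cong: if_cong)
    then show ?thesis unfolding M' using K_0 K_1 by (auto intro!: exI[of _ "\<lambda>y. if y = x then 1 else 0"])
  qed
  have "seq.span B \<subseteq> {v. v j = 0}"
    using BM by (intro seq.span_minimal) (auto simp: seq.subspace_def)
  then have m_span: "m \<notin> seq.span B" using m by auto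
  then have m_B: "m \<notin> B" using seq.span_base by blast
  have "lattice_basis seq_scale K M (insert m B)"
    unfolding lattice_basis_def
  proof (intro conjI)
    show "\<not> seq.dependent (insert m B)" using ind m_span by (simp add: seq.independent_insert)
    show "M = {\<Sum>b\<in>insert m B. seq_scale (c b) b | c. c \<in> insert m B \<rightarrow> K}" (is "_ = ?S")
    proof (intro equalityI subsetI)
      fix v assume v: "v \<in> M"
      then obtain a where a: "a \<in> K" "v j = a * m j" using gen by blast
      have "v + seq_scale (- a) m \<in> M"
        using v m a by (intro M_add M_scale K_minus)
      then have "v + seq_scale (- a) m \<in> ?M'" using a by simp
      then obtain c where c: "c \<in> B \<rightarrow> K" "v + seq_scale (- a) m = (\<Sum>b\<in>B. seq_scale (c b) b)"
        unfolding M' by blast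
      have "v = seq_scale a m + (v + seq_scale (- a) m)"
        by (simp add: fun_eq_iff)
      also have "\<dots> = seq_scale a m + (\<Sum>b\<in>B. seq_scale (c b) b)" unfolding c(2) ..
      also have "\<dots> = (\<Sum>b\<in>insert m B. seq_scale ((c(m := a)) b) b)"
      proof -
        have "(\<Sum>b\<in>B. seq_scale (c b) b) = (\<Sum>b\<in>B. seq_scale ((c(m := a)) b) b)"
          using m_B by (intro sum.cong) auto
        then show ?thesis using fin m_B by simp
      qed
      finally have "v = (\<Sum>b\<in>insert m B. seq_scale ((c(m := a)) b) b)" .
      moreover have "c(m := a) \<in> insert m B \<rightarrow> K" using c a by auto
      ultimately show "v \<in> ?S" by blast
    next
      fix v assume "v \<in> ?S"
      then obtain c where c: "c \<in> insert m B \<rightarrow> K" "v = (\<Sum>b\<in>insert m B. seq_scale (c b) b)" by blast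
      have "(\<Sum>b\<in>B. seq_scale (c b) b) \<in> ?M'" unfolding M' using c by auto
      then show "v \<in> M" using c fin m_B m by (auto intro!: M_add M_scale)
    qed
  qed (use fin in auto)
  moreover have "card (insert m B) = card (insert j J)"
    using fin m_B cardB insert.hyps by simp
  ultimately show ?case by blast
qed


section \<open>Coordinates, characters and the action\<close>

text \<open>A coordinate is addressed by a triple: the isotypic component \<open>c\<close>, the number \<open>i\<close> of a copy of the
  corresponding small lattice, and the position \<open>k\<close> inside this copy.\<close>

definition ix :: "nat \<Rightarrow> nat \<Rightarrow> nat \<Rightarrow> nat" where
  "ix c i k = prod_encode (c, prod_encode (i, k))"

lemma ix_eq_iff [simp]: "ix c i k = ix c' i' k' \<longleftrightarrow> c = c' \<and> i = i' \<and> k = k'"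
  by (auto simp: ix_def)

lemma ix_cases: obtains c i k where "j = ix c i k"
proof -
  obtain c l where "j = prod_encode (c, l)"
    by (metis prod_decode_inverse surj_pair)
  moreover obtain i k where "l = prod_encode (i, k)"
    by (metis prod_decode_inverse surj_pair)
  ultimately show ?thesis using that by (simp add: ix_def)
qed

definition vec :: "(nat \<Rightarrow> nat \<Rightarrow> nat \<Rightarrow> 'f) \<Rightarrow> nat \<Rightarrow> 'f" where
  "vec h j = (case prod_decode j of (c, l) \<Rightarrow> case prod_decode l of (i, k) \<Rightarrow> h c i k)"

lemma vec_ix [simp]: "vec h (ix c i k) = h c i k"
  by (simp add: vec_def ix_def)

lemma vec_eqI: "(\<And>c i k. v (ix c i k) = w (ix c i k)) \<Longrightarrow> v = w"
  by (metis ext ix_cases)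

lemma sum_shift_mod:
  assumes "0 < (p::nat)"
  shows "(\<Sum>k<p. f ((k + s) mod p)) = (\<Sum>k<p. f k)"
proof -
  have s: "s mod p < p" using assms by simp
  have "(\<Sum>k<p. f ((k + s) mod p)) = (\<Sum>k<p. f ((k + s mod p) mod p))"
    by (simp add: mod_simps)
  also have "\<dots> = (\<Sum>k<p. f k)"
  proof (rule sum.reindex_bij_witness[where i = "\<lambda>k. (k + (p - s mod p)) mod p" and j = "\<lambda>k. (k + s mod p) mod p"])
    fix k assume k: "k \<in> {..<p}"
    have *: "k + s mod p + (p - s mod p) = k + p" "k + (p - s mod p) + s mod p = k + p"
      using s by auto
    show "((k + s mod p) mod p + (p - s mod p)) mod p = k"
      and "((k + (p - s mod p)) mod p + s mod p) mod p = k"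
      using * k by (simp_all only: mod_add_left_eq) simp_all
  qed (use assms in auto)
  finally show ?thesis .
qed

lemma sum_first_two:
  assumes "1 < (q::nat)" "\<And>k. k \<ge> 2 \<Longrightarrow> f k = (0::'x::comm_monoid_add)"
  shows "(\<Sum>k<q. f k) = f 0 + f 1"
proof -
  have "(\<Sum>k<q. f k) = (\<Sum>k\<in>{0,1}. f k)"
    using assms by (intro sum.mono_neutral_right) auto
  then show ?thesis by simp
qed

text \<open>The functions \<open>\<alpha>\<close> and \<open>\<beta>\<close> are the two coordinates of an isomorphism from \<open>G\<close> to the direct product of
  two cyclic groups of order \<open>p\<close>. The parameter \<open>n\<close> governs the rank. It is at least \<open>2\<close> because the
  cocycle needs three different coordinates \<open>0\<close>, \<open>1\<close>, \<open>n\<close> in the trivial component.\<close>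

locale cp_cp_lattice = p_local_domain p K + group G
  for p :: nat and K :: "'f::field set" and G :: "('g, 'b) monoid_scheme" (structure) +
  fixes \<alpha> \<beta> :: "'g \<Rightarrow> nat" and n :: nat
  assumes n_ge_2: "2 \<le> n"
    and finite_G: "finite (carrier G)"
    and \<alpha>_less: "g \<in> carrier G \<Longrightarrow> \<alpha> g < p" and \<beta>_less: "g \<in> carrier G \<Longrightarrow> \<beta> g < p"
    and \<alpha>_mult: "g \<in> carrier G \<Longrightarrow> h \<in> carrier G \<Longrightarrow> \<alpha> (g \<otimes> h) = (\<alpha> g + \<alpha> h) mod p"
    and \<beta>_mult: "g \<in> carrier G \<Longrightarrow> h \<in> carrier G \<Longrightarrow> \<beta> (g \<otimes> h) = (\<beta> g + \<beta> h) mod p"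
    and coords_inj: "g \<in> carrier G \<Longrightarrow> h \<in> carrier G \<Longrightarrow> \<alpha> g = \<alpha> h \<Longrightarrow> \<beta> g = \<beta> h \<Longrightarrow> g = h"
    and coords_surj: "a < p \<Longrightarrow> b < p \<Longrightarrow> \<exists>g\<in>carrier G. \<alpha> g = a \<and> \<beta> g = b"
begin

text \<open>The kernels of \<open>\<chi> 0, \<dots>, \<chi> p\<close> are the \<open>p + 1\<close> subgroups of order \<open>p\<close>. The index \<open>p + 1\<close> stands
  for the trivial component, on which the same formula for the action applies with the character \<open>0\<close>.\<close>

definition \<chi> :: "nat \<Rightarrow> 'g \<Rightarrow> nat" where
  "\<chi> c g = (if c < p then (\<beta> g + c * \<alpha> g) mod p else if c = p then \<alpha> g else 0)"

lemma \<chi>_less: "g \<in> carrier G \<Longrightarrow> \<chi> c g < p"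
  using p_gt_0 \<alpha>_less by (auto simp: \<chi>_def)

lemma \<chi>_mult:
  assumes "g \<in> carrier G" "h \<in> carrier G"
  shows "\<chi> c (g \<otimes> h) = (\<chi> c g + \<chi> c h) mod p"
proof -
  have "((b + b') mod p + c * ((a + a') mod p)) mod p = ((b + c * a) mod p + (b' + c * a') mod p) mod p"
    for a a' b b' :: nat
  proof -
    have "((b + b') mod p + c * ((a + a') mod p)) mod p = (b + b' + c * (a + a')) mod p"
      by (rule mod_add_cong) (simp_all add: mod_mult_right_eq)
    also have "\<dots> = ((b + c * a) mod p + (b' + c * a') mod p) mod p"
      by (simp add: mod_add_eq algebra_simps)
    finally show ?thesis .
  qed
  then show ?thesis using assms by (simp add: \<chi>_def \<alpha>_mult \<beta>_mult)
qed

lemma \<chi>_one [simp]: "\<chi> c \<one> = 0"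
proof -
  have "\<chi> c \<one> = (\<chi> c \<one> + \<chi> c \<one>) mod p" using \<chi>_mult[of \<one> \<one> c] by simp
  then have "p dvd \<chi> c \<one>"
    using \<chi>_less[of \<one> c] by (metis add_diff_cancel_left' mod_eq_dvd_iff_nat mod_less le_add1 one_closed)
  then show ?thesis using \<chi>_less[of \<one> c] by (auto dest: dvd_imp_le)
qed

lemma \<chi>_pow: "g \<in> carrier G \<Longrightarrow> \<chi> c (g [^] (j::nat)) = (j * \<chi> c g) mod p"
  by (induction j) (simp_all add: \<chi>_mult mod_simps algebra_simps)

text \<open>The action permutes the coordinates: in the component \<open>c\<close> it is the cyclic shift of the first \<open>p\<close>
  positions by \<open>\<chi> c g\<close>. Hence it is linear on the space of all sequences.\<close>

definition act :: "'g \<Rightarrow> (nat \<Rightarrow> 'f) \<Rightarrow> nat \<Rightarrow> 'f" where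
  "act g v = vec (\<lambda>c i k. v (ix c i (if k < p then (k + \<chi> c g) mod p else k)))"

lemma act_ix: "k < p \<Longrightarrow> act g v (ix c i k) = v (ix c i ((k + \<chi> c g) mod p))"
  by (simp add: act_def)

lemma act_ix_trivial: "g \<in> carrier G \<Longrightarrow> \<chi> c g = 0 \<Longrightarrow> act g v (ix c i k) = v (ix c i k)"
  by (simp add: act_def)

lemma act_add: "act g (v + w) = act g v + act g w"
  by (rule vec_eqI) (simp add: act_def)

lemma act_scale: "act g (seq_scale a v) = seq_scale a (act g v)"
  by (rule vec_eqI) (simp add: act_def)

lemma act_0 [simp]: "act g 0 = 0"
  by (rule vec_eqI) (simp add: act_def)

lemma act_one [simp]: "act \<one> v = v"
  by (rule vec_eqI) (simp add: act_def)

lemma act_mult: "g \<in> carrier G \<Longrightarrow> h \<in> carrier G \<Longrightarrow> act (g \<otimes> h) v = act g (act h v)"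
proof (rule vec_eqI)
  fix c i k assume "g \<in> carrier G" "h \<in> carrier G"
  then show "act (g \<otimes> h) v (ix c i k) = act g (act h v) (ix c i k)"
    by (cases "k < p") (auto simp: act_def \<chi>_mult mod_simps algebra_simps)
qed

lemma act_inv: "g \<in> carrier G \<Longrightarrow> act g (act (inv g) v) = v" "g \<in> carrier G \<Longrightarrow> act (inv g) (act g v) = v"
  using act_mult[of g "inv g" v] act_mult[of "inv g" g v] by simp_all


section \<open>The lattice\<close>

text \<open>For \<open>c \<le> p\<close> the component \<open>c\<close> consists of \<open>n\<close> functions on the integers modulo \<open>p\<close> with sum zero, so that
  the subgroup \<open>\<chi> c = 0\<close> fixes it and every other subgroup of order \<open>p\<close> has no nonzero fixed vector in it. The
  trivial component has \<open>n + 1\<close> coordinates.\<close>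

definition ambient :: "(nat \<Rightarrow> 'f) set" where
  "ambient = {v. (\<forall>c i k. v (ix c i k) \<noteq> 0 \<longrightarrow> c \<le> p \<and> i < n \<and> k < p \<or> c = Suc p \<and> i \<le> n \<and> k = 0) \<and>
             (\<forall>c\<le>p. \<forall>i. (\<Sum>k<p. v (ix c i k)) = 0)}"

definition ambient_K :: "(nat \<Rightarrow> 'f) set" where
  "ambient_K = {v \<in> ambient. \<forall>j. v j \<in> K}"

text \<open>Modulo \<open>p\<close>, shifting \<open>v\<close> changes \<open>\<Sum> k * v k\<close> by a multiple of \<open>\<Sum> v k = 0\<close>. So \<open>residue\<close> is a \<open>G\<close>-invariant
  map from each small lattice to \<open>K/pK\<close>; its kernel is described by \<open>residue_kernel\<close> below.\<close>

definition residue :: "nat \<Rightarrow> (nat \<Rightarrow> 'f) \<Rightarrow> nat \<Rightarrow> 'f" where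
  "residue c v i = (if c \<le> p then \<Sum>k<p. of_nat k * v (ix c i k) else v (ix c i 0))"

text \<open>Reading \<open>f\<close> and \<open>g\<close> as polynomials of degree less than \<open>n\<close>, the residues prescribed in the components
  are \<open>f\<close>, \<open>f - g\<close>, \<open>g\<close> (for all other nontrivial characters) and \<open>X * f - g\<close>. The kernels of
  these four maps form an indecomposable system of four subspaces. The residues in the components \<open>p\<close>
  and \<open>0\<close> are \<open>f\<close> and \<open>g\<close> themselves, which allows to define \<open>lat\<close> without mentioning a pair \<open>(f, g)\<close>.\<close>

definition glue :: "nat \<Rightarrow> (nat \<Rightarrow> 'f) \<Rightarrow> (nat \<Rightarrow> 'f) \<Rightarrow> nat \<Rightarrow> 'f" where
  "glue c f g i =
     (if c = p then f i else if c = 1 then f i - g i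
      else if c < p then g i else (case i of 0 \<Rightarrow> 0 | Suc j \<Rightarrow> f j) - g i)"

definition lat :: "(nat \<Rightarrow> 'f) set" where
  "lat = {v \<in> ambient_K. \<forall>c\<le>Suc p. \<forall>i. residue c v i \<approx>\<^sub>p glue c (residue p v) (residue 0 v) i}"

lemma ambient_supp: "v \<in> ambient \<Longrightarrow> \<not> (c \<le> p \<and> i < n \<and> k < p \<or> c = Suc p \<and> i \<le> n \<and> k = 0) \<Longrightarrow> v (ix c i k) = 0"
  unfolding ambient_def by blast

lemma ambient_sum: "v \<in> ambient \<Longrightarrow> c \<le> p \<Longrightarrow> (\<Sum>k<p. v (ix c i k)) = 0"
  unfolding ambient_def by blast

lemma ambientI: "(\<And>c i k. \<not> (c \<le> p \<and> i < n \<and> k < p \<or> c = Suc p \<and> i \<le> n \<and> k = 0) \<Longrightarrow> v (ix c i k) = 0) \<Longrightarrow>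
   (\<And>c i. c \<le> p \<Longrightarrow> (\<Sum>k<p. v (ix c i k)) = 0) \<Longrightarrow> v \<in> ambient"
  unfolding ambient_def by blast

lemma ambient_subspace: "seq.subspace ambient"
proof (rule seq.subspaceI)
  fix v w assume "v \<in> ambient" "w \<in> ambient"
  then show "v + w \<in> ambient"
    by (intro ambientI) (simp_all add: ambient_supp ambient_sum sum.distrib)
next
  fix a v assume "v \<in> ambient"
  then show "seq_scale a v \<in> ambient"
    by (intro ambientI) (simp_all add: ambient_supp ambient_sum sum_distrib_left[symmetric])
qed (auto intro: ambientI)

lemma act_ambient: assumes g: "g \<in> carrier G" and v: "v \<in> ambient" shows "act g v \<in> ambient"
proof (rule ambientI)
  fix c i k assume *: "\<not> (c \<le> p \<and> i < n \<and> k < p \<or> c = Suc p \<and> i \<le> n \<and> k = 0)"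
  show "act g v (ix c i k) = 0"
  proof (cases "c \<le> p")
    case True
    then show ?thesis using * by (auto simp: act_def p_gt_0 intro!: ambient_supp[OF v])
  next
    case False
    then have "\<chi> c g = 0" by (simp add: \<chi>_def)
    then show ?thesis using ambient_supp[OF v *] by (simp add: act_def)
  qed
next
  fix c i assume "c \<le> p"
  then show "(\<Sum>k<p. act g v (ix c i k)) = 0"
    using sum_shift_mod[OF p_gt_0, of "\<lambda>k. v (ix c i k)" "\<chi> c g"] ambient_sum[OF v]
    by (simp add: act_ix)
qed

lemma ambient_K_add: "v \<in> ambient_K \<Longrightarrow> w \<in> ambient_K \<Longrightarrow> v + w \<in> ambient_K"
  using seq.subspace_add[OF ambient_subspace] by (simp add: ambient_K_def K_add)

lemma ambient_K_scale: "a \<in> K \<Longrightarrow> v \<in> ambient_K \<Longrightarrow> seq_scale a v \<in> ambient_K"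
  using seq.subspace_scale[OF ambient_subspace] by (simp add: ambient_K_def K_mult)

lemma ambient_K_ambient: "v \<in> ambient_K \<Longrightarrow> v \<in> ambient" and ambient_K_K: "v \<in> ambient_K \<Longrightarrow> v j \<in> K"
  by (auto simp: ambient_K_def)

lemma ambient_K_diff: "v \<in> ambient_K \<Longrightarrow> w \<in> ambient_K \<Longrightarrow> v - w \<in> ambient_K"
  using seq.subspace_diff[OF ambient_subspace] by (simp add: ambient_K_def K_diff)

lemma act_ambient_K: "g \<in> carrier G \<Longrightarrow> v \<in> ambient_K \<Longrightarrow> act g v \<in> ambient_K"
proof -
  assume g: "g \<in> carrier G" and v: "v \<in> ambient_K"
  have "act g v j \<in> K" for j
    by (rule ix_cases[of j]) (simp add: act_def ambient_K_K[OF v])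
  then show ?thesis using act_ambient[OF g ambient_K_ambient[OF v]] by (simp add: ambient_K_def)
qed

lemma residue_add: "residue c (v + w) i = residue c v i + residue c w i"
  and residue_diff: "residue c (v - w) i = residue c v i - residue c w i"
  and residue_scale: "residue c (seq_scale a v) i = a * residue c v i"
  and residue_0 [simp]: "residue c 0 i = 0"
  by (simp_all add: residue_def algebra_simps sum.distrib sum_subtractf sum_distrib_left)

lemma residue_sum: "finite A \<Longrightarrow> residue c (sum f A) i = (\<Sum>a\<in>A. residue c (f a) i)"
proof (induction A rule: finite_induct)
  case (insert a A)
  then show ?case using residue_add[of c "f a" "sum f A" i] by (simp only: sum.insert[OF insert.hyps])
qed (simp only: sum.empty residue_0)

lemma residue_K: "v \<in> ambient_K \<Longrightarrow> residue c v i \<in> K"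
  by (simp add: residue_def K_sum K_mult K_of_nat ambient_K_K)

lemma residue_supp: "v \<in> ambient \<Longrightarrow> i \<ge> n \<Longrightarrow> c \<le> p \<Longrightarrow> residue c v i = 0"
  by (simp add: residue_def ambient_supp)

text \<open>The factor \<open>k\<close> in the residue differs from \<open>(k + s) mod p\<close> by \<open>s\<close> and a multiple of \<open>p\<close>; the
  contribution of \<open>s\<close> vanishes because the entries have sum zero.\<close>

lemma residue_act:
  assumes g: "g \<in> carrier G" and v: "v \<in> ambient_K"
  shows "residue c (act g v) i \<approx>\<^sub>p residue c v i"
proof (cases "c \<le> p")
  case False
  then have "\<chi> c g = 0" by (simp add: \<chi>_def)
  then show ?thesis using False by (simp add: residue_def act_def p_gt_0)
next
  case True
  let ?s = "\<chi> c g"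
  let ?w = "\<lambda>k. v (ix c i ((k + ?s) mod p))"
  have "residue c v i = (\<Sum>k<p. of_nat ((k + ?s) mod p) * ?w k)"
    using True sum_shift_mod[OF p_gt_0, of "\<lambda>k. of_nat k * v (ix c i k)" ?s]
    by (simp add: residue_def)
  moreover have "(\<Sum>k<p. ?w k) = 0"
    using sum_shift_mod[OF p_gt_0, of "\<lambda>k. v (ix c i k)" ?s] ambient_sum[OF ambient_K_ambient[OF v] True] by simp
  moreover have "of_nat k = of_nat p * of_nat ((k + ?s) div p) + of_nat ((k + ?s) mod p) - (of_nat ?s :: 'f)" for k
  proof -
    have "k + ?s = p * ((k + ?s) div p) + (k + ?s) mod p" by simp
    then have "of_nat (k + ?s) = (of_nat (p * ((k + ?s) div p) + (k + ?s) mod p) :: 'f)" by (rule arg_cong)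
    then have "of_nat k + of_nat ?s = (of_nat p * of_nat ((k + ?s) div p) + of_nat ((k + ?s) mod p) :: 'f)"
      by (simp only: of_nat_add of_nat_mult)
    then show ?thesis by (simp only: eq_diff_eq)
  qed
  then have "(\<Sum>k<p. of_nat k * ?w k) = of_nat p * (\<Sum>k<p. of_nat ((k + ?s) div p) * ?w k)
      + (\<Sum>k<p. of_nat ((k + ?s) mod p) * ?w k) - of_nat ?s * (\<Sum>k<p. ?w k)"
  proof -
    assume *: "\<And>k. of_nat k = of_nat p * of_nat ((k + ?s) div p) + of_nat ((k + ?s) mod p) - (of_nat ?s :: 'f)"
    have "(\<Sum>k<p. of_nat k * ?w k) = (\<Sum>k<p. of_nat p * (of_nat ((k + ?s) div p) * ?w k)
        + of_nat ((k + ?s) mod p) * ?w k - of_nat ?s * ?w k)"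
    proof (rule sum.cong[OF refl])
      fix k
      show "of_nat k * ?w k = of_nat p * (of_nat ((k + ?s) div p) * ?w k)
          + of_nat ((k + ?s) mod p) * ?w k - of_nat ?s * ?w k"
        by (subst *[of k]) (simp only: distrib_right left_diff_distrib mult.assoc)
    qed
    then show ?thesis by (simp only: sum.distrib sum_subtractf sum_distrib_left)
  qed
  ultimately have "residue c (act g v) i - residue c v i = of_nat p * (\<Sum>k<p. of_nat ((k + ?s) div p) * ?w k)"
    using True by (simp add: residue_def act_ix)
  then show ?thesis
    unfolding pcong_def by (intro bexI) (auto intro!: K_sum K_mult K_of_nat ambient_K_K[OF v])
qed

lemma glue_add: "glue c (\<lambda>i. f i + f' i) (\<lambda>i. g i + g' i) i = glue c f g i + glue c f' g' i"
  and glue_scale: "glue c (\<lambda>i. a * f i) (\<lambda>i. a * g i) i = a * glue c f g i"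
  by (auto simp: glue_def algebra_simps split: nat.split)

lemma glue_cong:
  "(\<And>i. f i \<approx>\<^sub>p f' i) \<Longrightarrow> (\<And>i. g i \<approx>\<^sub>p g' i) \<Longrightarrow> glue c f g i \<approx>\<^sub>p glue c f' g' i"
  by (auto simp: glue_def intro!: pcong_diff pcong_minus split: nat.split)

lemma glue_K: "(\<And>i. f i \<in> K) \<Longrightarrow> (\<And>i. g i \<in> K) \<Longrightarrow> glue c f g i \<in> K"
  by (auto simp: glue_def K_0 intro!: K_diff K_minus split: nat.split)

lemma glue_p [simp]: "glue p f g = f" and glue_0 [simp]: "glue 0 f g = g"
  using p_gt_1 by (auto simp: glue_def)

lemma lat_ambient_K: "v \<in> lat \<Longrightarrow> v \<in> ambient_K" and lat_ambient: "v \<in> lat \<Longrightarrow> v \<in> ambient"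
  and lat_K: "v \<in> lat \<Longrightarrow> v j \<in> K"
  by (auto simp: lat_def ambient_K_def)

lemma lat_glue: "v \<in> lat \<Longrightarrow> c \<le> Suc p \<Longrightarrow> residue c v i \<approx>\<^sub>p glue c (residue p v) (residue 0 v) i"
  by (simp add: lat_def)

lemma latI: "v \<in> ambient_K \<Longrightarrow> (\<And>c i. c \<le> Suc p \<Longrightarrow> residue c v i \<approx>\<^sub>p glue c (residue p v) (residue 0 v) i) \<Longrightarrow> v \<in> lat"
  by (simp add: lat_def)

lemma residue_fun: "residue c (v + w) = (\<lambda>i. residue c v i + residue c w i)" "residue c (seq_scale a v) = (\<lambda>i. a * residue c v i)"
  by (simp_all add: fun_eq_iff residue_add residue_scale)

lemma lat_add: "v \<in> lat \<Longrightarrow> w \<in> lat \<Longrightarrow> v + w \<in> lat"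
  by (rule latI) (simp_all add: lat_ambient_K ambient_K_add residue_fun glue_add pcong_add lat_glue)

lemma lat_scale: "a \<in> K \<Longrightarrow> v \<in> lat \<Longrightarrow> seq_scale a v \<in> lat"
  by (rule latI) (simp_all add: lat_ambient_K ambient_K_scale residue_fun glue_scale pcong_scale lat_glue)

lemma p_ambient_K_lat: "v \<in> ambient_K \<Longrightarrow> seq_scale (of_nat p) v \<in> lat"
proof (rule latI)
  fix c i assume v: "v \<in> ambient_K"
  show "residue c (seq_scale (of_nat p) v) i
      \<approx>\<^sub>p glue c (residue p (seq_scale (of_nat p) v)) (residue 0 (seq_scale (of_nat p) v)) i"
    unfolding residue_fun glue_scale
    using pcong_trans[OF pcong_p_mult pcong_sym[OF pcong_p_mult]] residue_K[OF v] glue_K[of "residue p v" "residue 0 v"]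
    by blast
qed (simp add: ambient_K_scale K_of_nat)

lemma lat_0: "0 \<in> lat"
proof (rule latI)
  show "0 \<in> ambient_K" using seq.subspace_0[OF ambient_subspace] by (simp add: ambient_K_def K_0)
qed (simp add: glue_def split: nat.split)

lemma lat_diff: "v \<in> lat \<Longrightarrow> w \<in> lat \<Longrightarrow> v - w \<in> lat"
proof -
  assume "v \<in> lat" "w \<in> lat"
  then have "v + seq_scale (- 1) w \<in> lat" by (intro lat_add lat_scale K_minus K_1)
  moreover have "v + seq_scale (- 1) w = v - w" by (simp add: fun_eq_iff)
  ultimately show ?thesis by simp
qed

lemma lat_act: "g \<in> carrier G \<Longrightarrow> v \<in> lat \<Longrightarrow> act g v \<in> lat"
proof (rule latI)
  fix c i assume g: "g \<in> carrier G" and v: "v \<in> lat" and c: "c \<le> Suc p"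
  have "residue c (act g v) i \<approx>\<^sub>p residue c v i" using residue_act[OF g lat_ambient_K[OF v]] .
  also have "residue c v i \<approx>\<^sub>p glue c (residue p v) (residue 0 v) i" using lat_glue[OF v c] .
  also have "glue c (residue p v) (residue 0 v) i \<approx>\<^sub>p glue c (residue p (act g v)) (residue 0 (act g v)) i"
    by (intro glue_cong pcong_sym[OF residue_act] g lat_ambient_K v)
  finally show "residue c (act g v) i \<approx>\<^sub>p glue c (residue p (act g v)) (residue 0 (act g v)) i" .
qed (simp add: act_ambient_K lat_ambient_K)

definition with_residues :: "(nat \<Rightarrow> nat \<Rightarrow> 'f) \<Rightarrow> nat \<Rightarrow> 'f" where
  "with_residues a = vec (\<lambda>c i k.
     if c \<le> p \<and> i < n then (if k = 0 then - a c i else if k = 1 then a c i else 0)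
     else if c = Suc p \<and> i \<le> n \<and> k = 0 then a c i else 0)"

lemma with_residues_ambient_K: "(\<And>c i. a c i \<in> K) \<Longrightarrow> with_residues a \<in> ambient_K"
proof -
  assume a: "\<And>c i. a c i \<in> K"
  have "with_residues a \<in> ambient"
  proof (rule ambientI)
    fix c i assume "c \<le> p"
    then show "(\<Sum>k<p. with_residues a (ix c i k)) = 0"
      using sum_first_two[OF p_gt_1, of "\<lambda>k. with_residues a (ix c i k)"] by (simp add: with_residues_def)
  qed (use p_gt_1 in \<open>auto simp: with_residues_def\<close>)
  moreover have "with_residues a j \<in> K" for j
    by (rule ix_cases[of j]) (simp add: with_residues_def a K_minus K_0)
  ultimately show ?thesis by (simp add: ambient_K_def)
qed

lemma residue_with_residues:
  assumes "\<And>c i. c \<le> p \<Longrightarrow> n \<le> i \<Longrightarrow> a c i = 0" and "\<And>i. n < i \<Longrightarrow> a (Suc p) i = 0" and "c \<le> Suc p"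
  shows "residue c (with_residues a) i = a c i"
proof (cases "c \<le> p")
  case True
  then show ?thesis
    using sum_first_two[OF p_gt_1, of "\<lambda>k. of_nat k * with_residues a (ix c i k)"] assms(1)[of c i]
    by (simp add: with_residues_def residue_def)
next
  case False
  then have "c = Suc p" using assms(3) by simp
  then show ?thesis using assms(2)[of i] by (auto simp: with_residues_def residue_def)
qed

definition glued :: "(nat \<Rightarrow> 'f) \<Rightarrow> (nat \<Rightarrow> 'f) \<Rightarrow> nat \<Rightarrow> 'f" where
  "glued f g = with_residues (\<lambda>c. glue c f g)"

context
  fixes f g
  assumes fK: "\<And>i. f i \<in> K" and gK: "\<And>i. g i \<in> K"
    and f_supp: "\<And>i. n \<le> i \<Longrightarrow> f i = 0" and g_supp: "\<And>i. n \<le> i \<Longrightarrow> g i = 0"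
begin

lemma residue_glued: "c \<le> Suc p \<Longrightarrow> residue c (glued f g) i = glue c f g i"
  unfolding glued_def using f_supp g_supp p_gt_1
  by (intro residue_with_residues) (auto simp: glue_def split: nat.split)

lemma glued_ambient_K: "glued f g \<in> ambient_K"
  unfolding glued_def by (intro with_residues_ambient_K glue_K fK gK)

lemma glued_lat: "glued f g \<in> lat"
proof (rule latI[OF glued_ambient_K])
  have "residue p (glued f g) = f" "residue 0 (glued f g) = g"
    by (simp_all add: fun_eq_iff residue_glued)
  then show "residue c (glued f g) i \<approx>\<^sub>p glue c (residue p (glued f g)) (residue 0 (glued f g)) i" if "c \<le> Suc p" for c i
    using residue_glued[OF that] by simp
qed

end

text \<open>Each of the maps in \<open>glue\<close> is onto. So there are residues \<open>(f, g)\<close> that induce the residue of the given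
  vector, and the other components can be filled accordingly.\<close>

lemma component_lift:
  assumes c: "c \<le> Suc p" and w: "w \<in> ambient_K"
  obtains m where "m \<in> lat" "\<And>i k. m (ix c i k) = w (ix c i k)"
proof -
  \<comment> \<open>In the trivial component \<open>f\<close> only has to provide the coefficient of degree \<open>n\<close> of \<open>X * f - g\<close>; all lower ones
    come from \<open>g\<close>.\<close>
  define f where "f i = (if c = p \<or> c = 1 then residue c w i else if c = Suc p \<and> Suc i = n then w (ix c n 0) else 0)" for i
  define g where "g i = (if c = p \<or> c = 1 then 0 else if c < p then residue c w i else if i < n then - w (ix c i 0) else 0)" for i
  have wamb: "w \<in> ambient" using w by (rule ambient_K_ambient)
  have fK: "f i \<in> K" and gK: "g i \<in> K" for i
    using residue_K[OF w] ambient_K_K[OF w] by (auto simp: f_def g_def K_0 K_minus)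
  have fs: "f i = 0" and gs: "g i = 0" if "n \<le> i" for i
    using that residue_supp[OF wamb that] p_gt_1 by (auto simp: f_def g_def)
  have gl: "glue c f g i = residue c w i" for i
  proof (cases "c = Suc p")
    case True
    then show ?thesis
      using p_gt_1 n_ge_2 ambient_supp[OF wamb, of "Suc p" i 0]
      by (auto simp: glue_def f_def g_def residue_def split: nat.split)
  next
    case False
    then show ?thesis using c p_gt_1 by (auto simp: glue_def f_def g_def)
  qed
  let ?s = "glued f g"
  have s: "?s \<in> ambient_K" by (rule glued_ambient_K) (use fK gK fs gs in auto)
  define m where "m = vec (\<lambda>d i k. if d = c then w (ix c i k) else ?s (ix d i k))"
  have mK: "m \<in> ambient_K"
  proof -
    have "m \<in> ambient"
    proof (rule ambientI)
      fix d i assume "d \<le> p"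
      then show "(\<Sum>k<p. m (ix d i k)) = 0"
        using ambient_sum[OF wamb, of d i] ambient_sum[OF ambient_K_ambient[OF s], of d i]
        by (cases "d = c") (simp_all add: m_def)
    next
      fix d i k assume *: "\<not> (d \<le> p \<and> i < n \<and> k < p \<or> d = Suc p \<and> i \<le> n \<and> k = 0)"
      show "m (ix d i k) = 0"
        using ambient_supp[OF wamb *] ambient_supp[OF ambient_K_ambient[OF s] *] by (auto simp: m_def)
    qed
    moreover have "m j \<in> K" for j
      by (rule ix_cases[of j]) (simp add: m_def ambient_K_K[OF w] ambient_K_K[OF s])
    ultimately show ?thesis by (simp add: ambient_K_def)
  qed
  have residue_m: "residue d m i = glue d f g i" if "d \<le> Suc p" for d i
  proof (cases "d = c")
    case True
    then show ?thesis using gl[of i] by (simp add: residue_def m_def)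
  next
    case False
    then have "residue d m i = residue d ?s i" by (simp add: residue_def m_def)
    then show ?thesis using residue_glued[of f g d i] fK gK fs gs that by simp
  qed
  have "residue p m = f" "residue 0 m = g" by (simp_all add: fun_eq_iff residue_m)
  then have "m \<in> lat" using residue_m by (intro latI mK) simp
  then show ?thesis using that[of m] by (simp add: m_def)
qed

end


section \<open>Indecomposability\<close>

lemma sum_arith_progression_mod:
  fixes s k p :: nat
  assumes "coprime s p" "0 < p"
  shows "(\<Sum>j<p. f ((k + j * s) mod p)) = (\<Sum>j<p. f j)"
proof -
  have inj: "inj_on (\<lambda>j. (k + j * s) mod p) {..<p}"
  proof (rule inj_onI)
    fix i j assume ij: "i \<in> {..<p}" "j \<in> {..<p}" and eq: "(k + i * s) mod p = (k + j * s) mod p"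
    have "int p dvd (int k + int i * int s) - (int k + int j * int s)"
      using eq by (metis mod_eq_dvd_iff of_nat_add of_nat_mult zmod_int)
    then have "int p dvd (int i - int j) * int s"
      by (simp add: algebra_simps)
    then have "int p dvd int i - int j"
      using assms(1) by (simp add: coprime_dvd_mult_left_iff coprime_commute)
    then have "int i mod int p = int j mod int p" by (simp add: mod_eq_dvd_iff)
    then show "i = j" using ij by simp
  qed
  have "(\<lambda>j. (k + j * s) mod p) ` {..<p} = {..<p}"
    using assms(2) by (intro endo_inj_surj inj) auto
  then show ?thesis using sum.reindex[OF inj, of f] by simp
qed

text \<open>Summation by parts. It computes the sum of a primitive of a function on the integers modulo \<open>p\<close>.\<close>

lemma sum_partial_sums:
  fixes f :: "nat \<Rightarrow> 'a::comm_ring_1"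
  shows "(\<Sum>k<q. \<Sum>j<k. f j) + (\<Sum>k<q. of_nat k * f k) + (\<Sum>k<q. f k) = of_nat q * (\<Sum>k<q. f k)"
  by (induction q) (simp_all add: algebra_simps)

context cp_cp_lattice
begin

text \<open>The operators of \<open>G\<close> are defined on all sequences here, whereas the action on the scalar extension
  has to be undefined outside of it.\<close>

definition submodule :: "(nat \<Rightarrow> 'f) set \<Rightarrow> bool" where
  "submodule U \<longleftrightarrow> U \<subseteq> lat \<and> 0 \<in> U \<and> (\<forall>u\<in>U. \<forall>v\<in>U. u + v \<in> U) \<and>
     (\<forall>a\<in>K. \<forall>u\<in>U. seq_scale a u \<in> U) \<and> (\<forall>g\<in>carrier G. \<forall>u\<in>U. act g u \<in> U)"

lemma submodule_lat: "submodule U \<Longrightarrow> u \<in> U \<Longrightarrow> u \<in> lat"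
  and submodule_0: "submodule U \<Longrightarrow> 0 \<in> U"
  and submodule_add: "submodule U \<Longrightarrow> u \<in> U \<Longrightarrow> v \<in> U \<Longrightarrow> u + v \<in> U"
  and submodule_scale: "submodule U \<Longrightarrow> a \<in> K \<Longrightarrow> u \<in> U \<Longrightarrow> seq_scale a u \<in> U"
  and submodule_act: "submodule U \<Longrightarrow> g \<in> carrier G \<Longrightarrow> u \<in> U \<Longrightarrow> act g u \<in> U"
  by (auto simp: submodule_def)

lemma submodule_diff:
  assumes "submodule U" "u \<in> U" "v \<in> U" shows "u - v \<in> U"
proof -
  have "u + seq_scale (- 1) v \<in> U"
    using assms by (intro submodule_add submodule_scale K_minus K_1)
  moreover have "u + seq_scale (- 1) v = u - v" by (simp add: fun_eq_iff)
  ultimately show ?thesis by simp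
qed

lemma submodule_sum:
  assumes U: "submodule U" and "finite A" and "\<And>a. a \<in> A \<Longrightarrow> f a \<in> U"
  shows "sum f A \<in> U"
  using assms(2,3)
proof (induction A rule: finite_induct)
  case empty
  show ?case using submodule_0[OF U] by (simp only: sum.empty)
next
  case (insert a A)
  have "f a + sum f A \<in> U"
    by (intro submodule_add[OF U] insert.IH insert.prems) auto
  then show ?case by (simp only: sum.insert[OF insert.hyps])
qed

text \<open>On a component fixed by \<open>h\<close> this is multiplication by \<open>p\<close>, on every other component it is zero. Hence
  combinations of norm maps single out one component.\<close>

definition norm_map :: "'g \<Rightarrow> (nat \<Rightarrow> 'f) \<Rightarrow> nat \<Rightarrow> 'f" where
  "norm_map h v = (\<Sum>j<p. act (h [^] j) v)"

lemma norm_map_apply: "norm_map h v i = (\<Sum>j<p. act (h [^] j) v i)"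
  by (simp add: norm_map_def sum_fun_apply)

lemma norm_map_submodule: "submodule U \<Longrightarrow> h \<in> carrier G \<Longrightarrow> u \<in> U \<Longrightarrow> norm_map h u \<in> U"
  unfolding norm_map_def by (intro submodule_sum submodule_act) auto

lemma norm_map_ambient: "h \<in> carrier G \<Longrightarrow> u \<in> ambient \<Longrightarrow> norm_map h u \<in> ambient"
  unfolding norm_map_def by (intro seq.subspace_sum[OF ambient_subspace] act_ambient) auto

lemma norm_map_fixed: "h \<in> carrier G \<Longrightarrow> \<chi> c h = 0 \<Longrightarrow> norm_map h v (ix c i k) = of_nat p * v (ix c i k)"
  by (simp add: norm_map_apply act_ix_trivial \<chi>_pow)

lemma norm_map_moved:
  assumes h: "h \<in> carrier G" and v: "v \<in> ambient" and c: "c \<le> p" "\<chi> c h \<noteq> 0"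
  shows "norm_map h v (ix c i k) = 0"
proof (cases "k < p")
  case True
  have "\<not> p dvd \<chi> c h" using \<chi>_less[OF h, of c] c(2) by (auto dest: dvd_imp_le)
  then have "coprime (\<chi> c h) p"
    using prime_p by (metis coprime_commute prime_imp_coprime)
  then show ?thesis
    using sum_arith_progression_mod[of "\<chi> c h" p "\<lambda>j. v (ix c i j)" k] ambient_sum[OF v c(1)] True p_gt_0 h
    by (simp add: norm_map_apply act_ix \<chi>_pow mod_simps)
next
  case False
  then show ?thesis using ambient_supp[OF norm_map_ambient[OF h v], of c i k] c by auto
qed

lemma \<chi>_kernel_element:
  assumes "c \<le> p"
  obtains h where "h \<in> carrier G" "\<chi> c h = 0" "\<And>d. d \<le> p \<Longrightarrow> d \<noteq> c \<Longrightarrow> \<chi> d h \<noteq> 0"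
proof (cases "c = p")
  case True
  obtain h where "h \<in> carrier G" "\<alpha> h = 0" "\<beta> h = 1" using coords_surj[of 0 1] p_gt_1 by auto
  then show ?thesis using that[of h] True p_gt_1 by (auto simp: \<chi>_def)
next
  case False
  then have c: "c < p" using assms by simp
  obtain h where h: "h \<in> carrier G" "\<alpha> h = 1" "\<beta> h = (p - c) mod p"
    using coords_surj[of 1 "(p - c) mod p"] p_gt_1 by auto
  have \<chi>_h: "\<chi> d h = (p - c + d) mod p" if "d < p" for d
    using that h by (simp add: \<chi>_def mod_add_left_eq del: Nat.add_diff_assoc2 Nat.diff_add_assoc2)
  have "(p - c + d) mod p \<noteq> 0" if "d < p" "d \<noteq> c" for d
  proof
    assume "(p - c + d) mod p = 0"
    then have "p dvd p - c + d" by auto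
    then obtain q where q: "p - c + d = p * q" by blast
    then have "p * q < p * 2" "0 < p * q" using that c by linarith+
    then have "q < 2" "0 < q" by (metis mult_less_cancel1, metis gr0I mult_0_right less_irrefl)
    then have "q = 1" by simp
    then show False using q that c by simp
  qed
  then have nz: "\<chi> d h \<noteq> 0" if "d < p" "d \<noteq> c" for d
    using that \<chi>_h by simp
  show ?thesis
  proof (rule that[OF h(1)])
    show "\<chi> c h = 0" using \<chi>_h[OF c] c by simp
    show "\<chi> d h \<noteq> 0" if "d \<le> p" "d \<noteq> c" for d
      using that nz[of d] h by (cases "d = p") (auto simp: \<chi>_def)
  qed
qed

lemma \<chi>_unit_element: "c \<le> p \<Longrightarrow> \<exists>h\<in>carrier G. \<chi> c h = 1"
proof -
  assume c: "c \<le> p"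
  obtain a where "a \<in> carrier G" "\<alpha> a = 1" "\<beta> a = 0" using coords_surj[of 1 0] p_gt_1 by auto
  moreover obtain b where "b \<in> carrier G" "\<alpha> b = 0" "\<beta> b = 1" using coords_surj[of 0 1] p_gt_1 by auto
  ultimately show ?thesis
    using c p_gt_1 by (cases "c = p") (force simp: \<chi>_def)+
qed

definition unit_shift :: "nat \<Rightarrow> 'g" where
  "unit_shift c = (SOME h. h \<in> carrier G \<and> \<chi> c h = 1)"

lemma unit_shift: "c \<le> p \<Longrightarrow> unit_shift c \<in> carrier G" "c \<le> p \<Longrightarrow> \<chi> c (unit_shift c) = 1"
  using someI_ex[of "\<lambda>h. h \<in> carrier G \<and> \<chi> c h = 1"] \<chi>_unit_element[of c] by (auto simp: unit_shift_def)

text \<open>On the integral vectors of the component \<open>c\<close>, the image of this map is the kernel of the residue. Its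
  \<open>p\<close>-th power is divisible by \<open>p\<close>; for \<open>c \<le> p\<close> this is because \<open>(X - 1)^p\<close> and \<open>X^p - 1\<close> agree modulo \<open>p\<close>.\<close>

definition radical_map :: "nat \<Rightarrow> (nat \<Rightarrow> 'f) \<Rightarrow> nat \<Rightarrow> 'f" where
  "radical_map c v = (if c \<le> p then act (unit_shift c) v - v else seq_scale (of_nat p) v)"

lemma radical_map_add: "radical_map c (v + w) = radical_map c v + radical_map c w"
  by (simp add: radical_map_def act_add seq.scale_right_distrib)

lemma radical_map_submodule: "submodule U \<Longrightarrow> u \<in> U \<Longrightarrow> radical_map c u \<in> U"
  by (simp add: radical_map_def submodule_diff submodule_act unit_shift submodule_scale K_of_nat)

lemma radical_map_shift: "c \<le> p \<Longrightarrow> k < p \<Longrightarrow> radical_map c v (ix c i k) = v (ix c i (Suc k mod p)) - v (ix c i k)"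
  by (simp add: radical_map_def act_ix unit_shift)

lemma radical_map_outside: "c \<le> p \<Longrightarrow> p \<le> k \<Longrightarrow> radical_map c v (ix c i k) = 0"
  by (simp add: radical_map_def act_def)

lemma radical_map_trivial: "radical_map (Suc p) v j = of_nat p * v j"
  by (simp add: radical_map_def)

lemma radical_map_cong:
  assumes "c \<le> Suc p" "\<And>i k. v (ix c i k) = w (ix c i k)"
  shows "radical_map c v (ix c i k) = radical_map c w (ix c i k)"
  using assms by (simp add: radical_map_def act_def)

lemma residue_cong: "(\<And>i k. v (ix c i k) = w (ix c i k)) \<Longrightarrow> residue c v i = residue c w i"
  by (simp add: residue_def)

lemma residue_radical_map: "v \<in> ambient_K \<Longrightarrow> residue c (radical_map c v) i \<approx>\<^sub>p 0"
  using pcong_diff[OF residue_act[OF unit_shift(1)] pcong_refl, of c v c i "residue c v i"] pcong_p_mult[OF residue_K]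
  by (auto simp: radical_map_def residue_diff residue_scale)

text \<open>A function of sum zero is the difference of its sequence of partial sums, which is determined up to
  a constant. By \<open>sum_partial_sums\<close> the sum of this sequence is minus the residue, so that a constant
  from \<open>K\<close> makes it zero if and only if \<open>p\<close> divides the residue.\<close>

lemma residue_kernel_ambient_K:
  assumes c: "c \<le> Suc p" and w: "w \<in> ambient_K" and r: "\<And>i. residue c w i \<approx>\<^sub>p 0"
  obtains v where "v \<in> ambient_K" "\<And>i k. w (ix c i k) = radical_map c v (ix c i k)"
proof -
  have wamb: "w \<in> ambient" using w by (rule ambient_K_ambient)
  have "\<forall>i. \<exists>y. y \<in> K \<and> residue c w i = of_nat p * y"
    using r by (auto simp: pcong_def)
  then obtain y where yK: "\<And>i. y i \<in> K" and y: "\<And>i. residue c w i = of_nat p * y i" by metis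
  show ?thesis
  proof (cases "c \<le> p")
    case True
    define s where "s i k = y i + (\<Sum>j<k. w (ix c i j))" for i k
    define v where "v = vec (\<lambda>d i k. if d = c \<and> i < n \<and> k < p then s i k else 0)"
    have "v \<in> ambient"
    proof (rule ambientI)
      fix d i assume "d \<le> p"
      show "(\<Sum>k<p. v (ix d i k)) = 0"
      proof (cases "d = c \<and> i < n")
        case True
        have "(\<Sum>k<p. s i k) = of_nat p * y i + (\<Sum>k<p. \<Sum>j<k. w (ix c i j))"
          by (simp add: s_def sum.distrib)
        also have "\<dots> = of_nat p * y i - residue c w i"
          using sum_partial_sums[of "\<lambda>k. w (ix c i k)" p] ambient_sum[OF wamb \<open>c \<le> p\<close>, of i] \<open>c \<le> p\<close>
          by (simp add: residue_def eq_neg_iff_add_eq_0)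
        finally show ?thesis using y[of i] True by (simp add: v_def)
      qed (auto simp: v_def)
    qed (use True in \<open>auto simp: v_def\<close>)
    moreover have "v j \<in> K" for j
      by (rule ix_cases[of j]) (simp add: v_def s_def K_0 K_add yK K_sum ambient_K_K[OF w])
    ultimately have vK: "v \<in> ambient_K" by (simp add: ambient_K_def)
    have "w (ix c i k) = radical_map c v (ix c i k)" for i k
    proof (cases "i < n \<and> k < p")
      case False
      then have "w (ix c i k) = 0" using ambient_supp[OF wamb, of c i k] True by auto
      then show ?thesis using False True radical_map_outside[of c k v i] radical_map_shift[of c k v i] p_gt_0
        by (cases "k < p") (auto simp: v_def)
    next
      case ik: True
      show ?thesis
      proof (cases "Suc k < p")
        case True
        then show ?thesis using ik \<open>c \<le> p\<close> radical_map_shift[of c k v i] by (simp add: v_def s_def)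
      next
        case False
        then have k: "Suc k = p" using ik by simp
        have "(\<Sum>j<k. w (ix c i j)) + w (ix c i k) = 0"
          using ambient_sum[OF wamb \<open>c \<le> p\<close>, of i] unfolding k[symmetric] by simp
        then have "w (ix c i k) = - (\<Sum>j<k. w (ix c i j))"
          by (simp add: eq_neg_iff_add_eq_0 add.commute)
        then show ?thesis
          using ik \<open>c \<le> p\<close> radical_map_shift[of c k v i] k by (simp add: v_def s_def)
      qed
    qed
    then show ?thesis using that vK by blast
  next
    case False
    then have c: "c = Suc p" using c by simp
    define v where "v = vec (\<lambda>d i k. if d = c \<and> i \<le> n \<and> k = 0 then y i else 0)"
    have "v \<in> ambient"
      by (rule ambientI) (auto simp: v_def c)
    moreover have "v j \<in> K" for j
      by (rule ix_cases[of j]) (simp add: v_def K_0 yK)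
    ultimately have vK: "v \<in> ambient_K" by (simp add: ambient_K_def)
    have "w (ix c i k) = radical_map c v (ix c i k)" for i k
      using y[of i] ambient_supp[OF wamb, of c i k] by (auto simp: c v_def radical_map_trivial residue_def)
    then show ?thesis using that vK by blast
  qed
qed

lemma residue_kernel:
  assumes c: "c \<le> Suc p" and w: "w \<in> ambient_K" and r: "\<And>i. residue c w i \<approx>\<^sub>p 0"
  obtains m where "m \<in> lat" "\<And>i k. w (ix c i k) = radical_map c m (ix c i k)"
proof -
  obtain v where v: "v \<in> ambient_K" "\<And>i k. w (ix c i k) = radical_map c v (ix c i k)"
    using residue_kernel_ambient_K[OF assms] by blast
  obtain m where m: "m \<in> lat" "\<And>i k. m (ix c i k) = v (ix c i k)"
    using component_lift[OF c v(1)] by blast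
  show ?thesis using that[of m] m v(2) radical_map_cong[OF c, of m v] by simp
qed

lemma radical_map_funpow_shift:
  assumes "c \<le> p" "k < p"
  shows "(radical_map c ^^ m) v (ix c i k) =
    (\<Sum>j\<le>m. (- 1) ^ (m - j) * of_nat (m choose j) * v (ix c i ((k + j) mod p)))"
  using assms(2)
proof (induction m arbitrary: k)
  case 0
  then show ?case by simp
next
  case (Suc m)
  define a where "a j = v (ix c i ((k + j) mod p))" for j
  have "(radical_map c ^^ Suc m) v (ix c i k)
      = (radical_map c ^^ m) v (ix c i (Suc k mod p)) - (radical_map c ^^ m) v (ix c i k)"
    using radical_map_shift[OF assms(1) Suc.prems] by simp
  also have "(radical_map c ^^ m) v (ix c i k) = (\<Sum>j\<le>m. (- 1) ^ (m - j) * of_nat (m choose j) * a j)"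
    using Suc by (simp add: a_def)
  also have "(radical_map c ^^ m) v (ix c i (Suc k mod p))
      = (\<Sum>j\<le>m. (- 1) ^ (m - j) * of_nat (m choose j) * a (Suc j))"
    using Suc.IH[of "Suc k mod p"] p_gt_0 by (simp add: a_def mod_simps)
  also have "(\<Sum>j\<le>m. (- 1) ^ (m - j) * of_nat (m choose j) * a (Suc j))
      - (\<Sum>j\<le>m. (- 1) ^ (m - j) * of_nat (m choose j) * a j)
      = (\<Sum>j\<le>Suc m. (- 1) ^ (Suc m - j) * of_nat (Suc m choose j) * a j)"
  proof -
    have 1: "(\<Sum>j\<le>m. (- 1) ^ (m - j) * of_nat (m choose j) * a j)
      = (- 1) ^ m * a 0 - (\<Sum>j\<le>m. (- 1) ^ (m - j) * of_nat (m choose Suc j) * a (Suc j))"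
    proof -
      have "(\<Sum>j\<le>m. (- 1) ^ (m - j) * of_nat (m choose j) * a j)
        = (\<Sum>j\<le>Suc m. (- 1) ^ (m - j) * of_nat (m choose j) * a j)"
        by (simp add: binomial_eq_0)
      also have "\<dots> = (- 1) ^ m * a 0 + (\<Sum>j\<le>m. (- 1) ^ (m - Suc j) * of_nat (m choose Suc j) * a (Suc j))"
        by (subst sum.atMost_Suc_shift) simp
      also have "(\<Sum>j\<le>m. (- 1) ^ (m - Suc j) * of_nat (m choose Suc j) * a (Suc j))
        = (\<Sum>j\<le>m. - ((- 1) ^ (m - j) * of_nat (m choose Suc j) * a (Suc j)))"
      proof (rule sum.cong[OF refl])
        fix j assume j: "j \<in> {..m}"
        show "(- 1) ^ (m - Suc j) * of_nat (m choose Suc j) * a (Suc j)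
          = - ((- 1) ^ (m - j) * of_nat (m choose Suc j) * a (Suc j))"
        proof (cases "j = m")
          case False
          then have "m - j = Suc (m - Suc j)" using j by simp
          then show ?thesis by simp
        qed (simp add: binomial_eq_0)
      qed
      finally show ?thesis by (simp add: sum_negf)
    qed
    have 2: "(\<Sum>j\<le>Suc m. (- 1) ^ (Suc m - j) * of_nat (Suc m choose j) * a j)
      = (- 1) ^ Suc m * a 0 + (\<Sum>j\<le>m. (- 1) ^ (m - j) * of_nat (Suc m choose Suc j) * a (Suc j))"
      by (subst sum.atMost_Suc_shift) simp
    show ?thesis unfolding 1 2 by (simp add: algebra_simps sum.distrib)
  qed
  finally show ?case by (simp add: a_def)
qed

lemma radical_map_funpow_trivial: "(radical_map (Suc p) ^^ m) v j = of_nat p ^ m * v j"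
  by (induction m) (simp_all add: radical_map_trivial)

lemma radical_map_funpow_outside: "c \<le> p \<Longrightarrow> p \<le> k \<Longrightarrow> (radical_map c ^^ Suc m) v (ix c i k) = 0"
  using radical_map_outside by simp

text \<open>All inner binomial coefficients are divisible by \<open>p\<close>, and the two outer terms contribute
  \<open>1 + (-1)^p\<close>. The factor \<open>q\<close> makes the statement fit for iteration.\<close>

lemma radical_map_funpow_p:
  assumes c: "c \<le> Suc p" and v: "\<And>i k. \<exists>y\<in>K. v (ix c i k) = q * y"
  shows "\<exists>y\<in>K. (radical_map c ^^ p) v (ix c i k) = of_nat p * q * y"
proof -
  have "\<forall>i k. \<exists>y. y \<in> K \<and> v (ix c i k) = q * y" using v by blast
  then obtain y where yK: "\<And>i k. y i k \<in> K" and y: "\<And>i k. v (ix c i k) = q * y i k" by metis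
  consider "c = Suc p" | "c \<le> p" "k < p" | "c \<le> p" "p \<le> k" using c by linarith
  then show ?thesis
  proof cases
    case 1
    have "(radical_map c ^^ p) v (ix c i k) = of_nat p * q * (of_nat (p ^ (p - 1)) * y i k)"
      using p_gt_0 unfolding 1 radical_map_funpow_trivial
      by (simp add: y[unfolded 1] power_eq_if[of _ p] algebra_simps)
    then show ?thesis using K_mult[OF K_of_nat yK] by blast
  next
    case 2
    let ?t = "\<lambda>j. (- 1) ^ (p - j) * of_nat (p choose j) * y i ((k + j) mod p)"
    have "(\<Sum>j\<le>p. ?t j) \<approx>\<^sub>p (\<Sum>j\<le>p. (if j = 0 then (- 1) ^ p * y i k else 0) + (if j = p then y i k else 0))"
    proof (rule pcong_sum)
      fix j assume j: "j \<in> {..p}"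
      consider "j = 0" | "j = p" | "0 < j" "j < p" using j by fastforce
      then show "?t j \<approx>\<^sub>p (if j = 0 then (- 1) ^ p * y i k else 0) + (if j = p then y i k else 0)"
      proof cases
        case 3
        then have "p dvd (p choose j)" using prime_p by (intro dvd_choose_prime) auto
        then have "of_nat (p choose j) \<approx>\<^sub>p 0" by (simp add: pcong_of_nat_0)
        moreover have "(- 1) ^ m \<in> K" for m by (induction m) (simp_all add: K_1 K_minus)
        ultimately show ?thesis
          using pcong_scale[OF K_mult[OF _ yK], of "(- 1) ^ (p - j)" "of_nat (p choose j)" 0 i "(k + j) mod p"] 3
          by (simp add: mult.commute mult.left_commute)
      qed (use 2 p_gt_0 in auto)
    qed
    also have "\<dots> = ((- 1) ^ p + 1) * y i k"
      by (simp add: sum.distrib algebra_simps)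
    also have "\<dots> \<approx>\<^sub>p 0"
    proof (cases "p = 2")
      case True
      then show ?thesis using pcong_p_mult[OF yK[of i k]] by simp
    next
      case False
      then have "odd p" using prime_p prime_odd_nat p_gt_1 by force
      then show ?thesis by simp
    qed
    finally obtain z where "z \<in> K" "(\<Sum>j\<le>p. ?t j) = of_nat p * z" by (auto simp: pcong_def)
    moreover have "(radical_map c ^^ p) v (ix c i k) = q * (\<Sum>j\<le>p. ?t j)"
      using 2 by (simp add: radical_map_funpow_shift y sum_distrib_left algebra_simps)
    ultimately show ?thesis by (auto simp: algebra_simps)
  next
    case 3
    then show ?thesis using radical_map_funpow_outside[of c k "p - 1" v i] p_gt_0 K_0 by (intro bexI[of _ 0]) auto
  qed
qed

text \<open>If two summands have vectors that agree in one component, then an element of the group ring that kills all other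
  components maps both vectors to the same element, which lies in both summands and so vanishes. On
  the component itself this element acts injectively. For \<open>c \<le> p\<close> it is \<open>h' - 1\<close> times the norm of the kernel of \<open>\<chi> c\<close>, where
  \<open>\<chi> c h' = 1\<close>; for the trivial component it is the product of the norms of two generators of \<open>G\<close>.\<close>

lemma component_isolation:
  assumes U: "submodule U" and W: "submodule W" and UW: "U \<inter> W = {0}" and u: "u \<in> U" and w: "w \<in> W"
    and c: "c \<le> Suc p" and eq: "\<And>i k. u (ix c i k) = w (ix c i k)"
  shows "u (ix c i k) = 0"
proof (cases "c \<le> p")
  case True
  obtain h where h: "h \<in> carrier G" "\<chi> c h = 0" "\<And>d. d \<le> p \<Longrightarrow> d \<noteq> c \<Longrightarrow> \<chi> d h \<noteq> 0"
    using \<chi>_kernel_element[OF True] by blast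
  let ?Q = "\<lambda>v. act (unit_shift c) (norm_map h v) - norm_map h v"
  have ambient: "u \<in> ambient" "w \<in> ambient" using u w U W submodule_lat lat_ambient by blast+
  have "?Q u \<in> U" "?Q w \<in> W"
    using u w U W h unit_shift[OF True] by (auto intro!: submodule_diff submodule_act norm_map_submodule)
  moreover have "?Q u = ?Q w"
  proof (rule vec_eqI)
    fix d i k
    consider "d = c" | "d \<le> p" "d \<noteq> c" | "p < d" by linarith
    then show "?Q u (ix d i k) = ?Q w (ix d i k)"
    proof cases
      case 1
      then show ?thesis using h(2) eq by (simp add: act_def norm_map_fixed[OF h(1)])
    next
      case 2
      then show ?thesis
        by (simp add: act_def norm_map_moved[OF h(1) ambient(1)] norm_map_moved[OF h(1) ambient(2)] h(3))
    next
      case 3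
      then have "\<chi> d (unit_shift c) = 0" by (simp add: \<chi>_def)
      then show ?thesis by (simp add: act_def)
    qed
  qed
  ultimately have "?Q u \<in> U \<inter> W" by simp
  then have "?Q u = 0" using UW by blast
  then have Q0: "?Q u (ix c i k) = 0" for k by (metis zero_fun_apply)
  have step: "u (ix c i (Suc k mod p)) = u (ix c i k)" if "k < p" for k
    using Q0[of k] that unit_shift[OF True] p_nonzero by (simp add: act_def norm_map_fixed[OF h(1,2)])
  have const: "u (ix c i k) = u (ix c i 0)" if "k < p" for k
    using that
  proof (induction k)
    case (Suc k)
    then show ?case using step[of k] by simp
  qed simp
  have "(\<Sum>k<p. u (ix c i k)) = (\<Sum>k<p. u (ix c i 0))"
    by (intro sum.cong refl const) simp
  then have "u (ix c i 0) = 0" using ambient_sum[OF ambient(1) True, of i] p_nonzero by simp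
  then show ?thesis
    using const[of k] ambient_supp[OF ambient(1), of c i k] True by (cases "k < p") (auto simp del: One_nat_def)
next
  case False
  then have c: "c = Suc p" using c by simp
  obtain a where a: "a \<in> carrier G" "\<alpha> a = 1" "\<beta> a = 0" using coords_surj[of 1 0] p_gt_1 by auto
  obtain b where b: "b \<in> carrier G" "\<alpha> b = 0" "\<beta> b = 1" using coords_surj[of 0 1] p_gt_1 by auto
  have ambient: "u \<in> ambient" "w \<in> ambient" using u w U W submodule_lat lat_ambient by blast+
  let ?Q = "\<lambda>v. norm_map a (norm_map b v)"
  have "?Q u \<in> U" "?Q w \<in> W" using u w U W a b by (auto intro!: norm_map_submodule)
  moreover have Qc: "?Q v (ix d i k) = of_nat p * (of_nat p * v (ix d i k))" if "p < d" for v d i k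
    using that a b by (simp add: norm_map_fixed \<chi>_def)
  have Q0: "?Q v (ix d i k) = 0" if v: "v \<in> ambient" and "d \<le> p" for v d i k
  proof (cases "d = p")
    case True
    then show ?thesis using norm_map_moved[OF a(1) norm_map_ambient[OF b(1) v], of p] a by (simp add: \<chi>_def)
  next
    case False
    then have z: "norm_map b v (ix d i k) = 0" for k
      using norm_map_moved[OF b(1) v, of d i k] b that p_gt_1 by (simp add: \<chi>_def)
    then show ?thesis by (simp add: norm_map_apply[of a] act_def)
  qed
  have supp: "v (ix d i k) = 0" if "v \<in> ambient" "Suc p < d" for v d i k
    using ambient_supp[OF that(1), of d i k] that(2) by simp
  have "?Q u = ?Q w"
  proof (rule vec_eqI)
    fix d i k
    consider "d = c" | "d \<le> p" | "Suc p < d" using c by linarith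
    then show "?Q u (ix d i k) = ?Q w (ix d i k)"
    proof cases
      case 3
      then show ?thesis using Qc[of d] supp[OF ambient(1) 3] supp[OF ambient(2) 3] by simp
    qed (use Qc[of d] eq c Q0[OF ambient(1)] Q0[OF ambient(2)] in auto)
  qed
  ultimately have "?Q u \<in> U \<inter> W" by simp
  then have "?Q u = 0" using UW by blast
  then have "?Q u (ix c i k) = 0" by (metis zero_fun_apply)
  then show ?thesis using Qc[of c u i k] c p_nonzero by simp
qed

end

text \<open>The aim is that one of the summands is zero. As the assumptions are symmetric, statements about \<open>U\<close>
  also hold for \<open>W\<close>.\<close>

locale lattice_decomposition = cp_cp_lattice +
  fixes U W :: "(nat \<Rightarrow> 'a) set"
  assumes submodule_U: "submodule U" and submodule_W: "submodule W" and disjoint: "U \<inter> W = {0}"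
    and spans: "m \<in> lat \<Longrightarrow> \<exists>u\<in>U. \<exists>w\<in>W. m = u + w"
begin

text \<open>In every component, the decomposition of the lattice induces one of the whole component, and the
  radical map respects it. If \<open>u + w\<close> is in the image of the radical map, then so is \<open>u\<close>.\<close>

lemma summand_radical:
  assumes u: "u \<in> U" and w: "w \<in> W" and c: "c \<le> Suc p" and r: "\<And>i. residue c (u + w) i \<approx>\<^sub>p 0"
  obtains u' where "u' \<in> U" "\<And>i k. u (ix c i k) = radical_map c u' (ix c i k)"
proof -
  have "u + w \<in> ambient_K" using u w submodule_lat[OF submodule_U] submodule_lat[OF submodule_W] lat_ambient_K ambient_K_add by blast
  then obtain m where m: "m \<in> lat" "\<And>i k. (u + w) (ix c i k) = radical_map c m (ix c i k)"
    using residue_kernel[OF c _ r] by blast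
  then obtain u' w' where u': "u' \<in> U" and w': "w' \<in> W" and mu: "m = u' + w'" using spans by blast
  have "(u - radical_map c u') (ix c i k) = (radical_map c w' - w) (ix c i k)" for i k
    using m(2)[of i k] by (simp add: mu radical_map_add algebra_simps)
  then have zero: "(u - radical_map c u') (ix c i k) = 0" for i k
    using component_isolation[OF submodule_U submodule_W disjoint submodule_diff[OF submodule_U u radical_map_submodule[OF submodule_U u']]
        submodule_diff[OF submodule_W radical_map_submodule[OF submodule_W w'] w] c] by blast
  show ?thesis using that[OF u'] zero by simp
qed

text \<open>The radical map kills residues. So the projection onto \<open>U\<close> induces an endomorphism of the residues in each
  component.\<close>

lemma residue_summand:
  assumes u: "u \<in> U" and w: "w \<in> W" and c: "c \<le> Suc p" and r: "\<And>i. residue c (u + w) i \<approx>\<^sub>p 0"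
  shows "residue c u i \<approx>\<^sub>p 0"
proof -
  obtain u' where u': "u' \<in> U" "\<And>i k. u (ix c i k) = radical_map c u' (ix c i k)"
    using summand_radical[OF assms] by blast
  then have "residue c u i = residue c (radical_map c u') i" by (intro residue_cong)
  then show ?thesis using residue_radical_map[of u' c i] u'(1) submodule_lat[OF submodule_U] lat_ambient_K by simp
qed

text \<open>Vanishing residues mean that each component of \<open>U\<close> is its own image under the radical map. Iteration
  shows that all entries are divisible by every power of \<open>p\<close>.\<close>

lemma summand_trivial_of_residue:
  assumes r: "\<And>u c i. u \<in> U \<Longrightarrow> c \<le> Suc p \<Longrightarrow> residue c u i \<approx>\<^sub>p 0"
  shows "U = {0}"
proof -
  have step: "\<exists>u'\<in>U. \<forall>i k. u (ix c i k) = (radical_map c ^^ m) u' (ix c i k)"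
    if c: "c \<le> Suc p" and u: "u \<in> U" for c u m
  proof (induction m)
    case 0
    then show ?case using u by auto
  next
    case (Suc m)
    then obtain u1 where u1: "u1 \<in> U" "\<forall>i k. u (ix c i k) = (radical_map c ^^ m) u1 (ix c i k)" by blast
    obtain u2 where u2: "u2 \<in> U" "\<And>i k. u1 (ix c i k) = radical_map c u2 (ix c i k)"
      using summand_radical[OF u1(1) submodule_0[OF submodule_W] c] r[OF u1(1) c] by auto
    have "(radical_map c ^^ m) u1 (ix c i k) = (radical_map c ^^ m) (radical_map c u2) (ix c i k)" for i k
    proof (induction m arbitrary: i k)
      case (Suc m)
      show ?case
        using radical_map_cong[OF c, of "(radical_map c ^^ m) u1" "(radical_map c ^^ m) (radical_map c u2)"] Suc by simp
    qed (simp add: u2)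
    then show ?case using u1 u2(1) by (auto simp: funpow_swap1 intro!: bexI[of _ u2])
  qed
  have power: "\<exists>y\<in>K. u (ix c i k) = of_nat (p ^ e) * y" if c: "c \<le> Suc p" and u: "u \<in> U" for c u i k e
    using u
  proof (induction e arbitrary: u i k)
    case 0
    then show ?case using lat_K[OF submodule_lat[OF submodule_U]] by auto
  next
    case (Suc e)
    obtain u' where u': "u' \<in> U" "\<forall>i k. u (ix c i k) = (radical_map c ^^ p) u' (ix c i k)"
      using step[OF c Suc.prems, of p] by blast
    obtain y where "y \<in> K" "(radical_map c ^^ p) u' (ix c i k) = of_nat p * of_nat (p ^ e) * y"
      using radical_map_funpow_p[OF c, of u' "of_nat (p ^ e)" i k] Suc.IH[OF u'(1)] by blast
    then show ?case using u'(2) by auto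
  qed
  have "u = 0" if u: "u \<in> U" for u
  proof (rule vec_eqI)
    fix c i k
    show "u (ix c i k) = 0 (ix c i k)"
    proof (cases "c \<le> Suc p")
      case True
      then show ?thesis
        using p_separated[OF lat_K[OF submodule_lat[OF submodule_U u]] power[OF True u]] by simp
    next
      case False
      then show ?thesis using ambient_supp[OF lat_ambient[OF submodule_lat[OF submodule_U u]], of c i k] by simp
    qed
  qed
  then show ?thesis using submodule_0[OF submodule_U] by blast
qed

end


context lattice_decomposition
begin

text \<open>The induced endomorphism of the pairs \<open>(f, g)\<close> preserves the subspaces \<open>g = 0\<close>, \<open>f = 0\<close>, \<open>f = g\<close> and
  \<open>X * f = g\<close>. By the first three it has the form \<open>(\<phi>, \<phi>)\<close>, and by the last one \<open>\<phi>\<close> commutes with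
  the multiplication by \<open>X\<close> on polynomials of degree less than \<open>n - 1\<close>. So the matrix of \<open>\<phi>\<close> is constant along its
  diagonals. An entry \<open>\<phi> i j\<close> with \<open>j < i\<close> is thereby moved to a constant coefficient of a multiple of \<open>X\<close>, one with
  \<open>i < j\<close> to a coefficient of degree at least \<open>n\<close>, and these are \<open>0\<close>. Therefore \<open>\<phi>\<close> is a scalar.\<close>

lemma residue_U_scalar:
  obtains s where "s \<in> K"
    and "\<And>u w c i. u \<in> U \<Longrightarrow> w \<in> W \<Longrightarrow> c = 0 \<or> c = p \<Longrightarrow> residue c u i \<approx>\<^sub>p s * residue c (u + w) i"
proof -
  define e :: "nat \<Rightarrow> nat \<Rightarrow> 'a" where "e i j = (if j = i then 1 else 0)" for i j
  define o0 :: "nat \<Rightarrow> 'a" where "o0 j = 0" for j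
  have eK: "e i j \<in> K" "o0 j \<in> K" for i j by (simp_all add: e_def o0_def K_0 K_1)
  have es: "e i j = 0" if "i < n" "n \<le> j" for i j using that by (simp add: e_def)
  have os: "o0 j = 0" for j by (simp add: o0_def)
  have "\<forall>i\<in>{..<n}. \<exists>x w. x \<in> U \<and> w \<in> W \<and> glued (e i) o0 = x + w"
    using spans[OF glued_lat] eK es os by (metis lessThan_iff)
  then obtain x wx where x: "\<And>i. i < n \<Longrightarrow> x i \<in> U" "\<And>i. i < n \<Longrightarrow> wx i \<in> W"
    "\<And>i. i < n \<Longrightarrow> glued (e i) o0 = x i + wx i" by (metis lessThan_iff)
  have "\<forall>i\<in>{..<n}. \<exists>x w. x \<in> U \<and> w \<in> W \<and> glued o0 (e i) = x + w"
    using spans[OF glued_lat] eK es os by (metis lessThan_iff)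
  then obtain y wy where y: "\<And>i. i < n \<Longrightarrow> y i \<in> U" "\<And>i. i < n \<Longrightarrow> wy i \<in> W"
    "\<And>i. i < n \<Longrightarrow> glued o0 (e i) = y i + wy i" by (metis lessThan_iff)
  have rx: "residue c (x i + wx i) j = glue c (e i) o0 j" if "i < n" "c \<le> Suc p" for c i j
    using residue_glued[of "e i" o0 c j] eK es os that x(3)[OF that(1)] by simp
  have ry: "residue c (y i + wy i) j = glue c o0 (e i) j" if "i < n" "c \<le> Suc p" for c i j
    using residue_glued[of o0 "e i" c j] eK es os that y(3)[OF that(1)] by simp
  define \<phi> where "\<phi> i j = residue p (x i) j" for i j
  \<comment> \<open>The three subspaces \<open>g = 0\<close>, \<open>f = 0\<close> and, in \<open>y0\<close> below, \<open>f = g\<close>.\<close>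
  have x0: "residue 0 (x i) j \<approx>\<^sub>p 0" if "i < n" for i j
    by (rule residue_summand[OF x(1)[OF that] x(2)[OF that]]) (simp_all add: that rx os)
  have yp: "residue p (y i) j \<approx>\<^sub>p 0" if "i < n" for i j
    by (rule residue_summand[OF y(1)[OF that] y(2)[OF that]]) (simp_all add: that ry os)
  have xy: "glue c (residue p (x i + y k)) (residue 0 (x i + y k)) j \<approx>\<^sub>p 0"
    if i: "i < n" and k: "k < n" and c: "c \<le> Suc p"
      and gl: "\<And>j. glue c (e i) o0 j + glue c o0 (e k) j = 0" for i k c j
  proof -
    have U: "x i + y k \<in> U" and W: "wx i + wy k \<in> W"
      using x y i k by (auto intro: submodule_add submodule_U submodule_W)
    have "residue c ((x i + y k) + (wx i + wy k)) j' = 0" for j'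
    proof -
      have "residue c ((x i + y k) + (wx i + wy k)) j' = residue c (x i + wx i) j' + residue c (y k + wy k) j'"
        by (simp only: residue_add add_ac)
      then show ?thesis by (simp only: rx[OF i c] ry[OF k c] gl)
    qed
    then have "residue c (x i + y k) j \<approx>\<^sub>p 0"
      by (intro residue_summand[OF U W c]) simp
    moreover have "residue c (x i + y k) j \<approx>\<^sub>p glue c (residue p (x i + y k)) (residue 0 (x i + y k)) j"
      by (rule lat_glue[OF submodule_lat[OF submodule_U U] c])
    ultimately show ?thesis by (metis pcong_sym pcong_trans)
  qed
  have y0: "residue 0 (y i) j \<approx>\<^sub>p \<phi> i j" if i: "i < n" for i j
  proof -
    have "(residue p (x i) j + residue p (y i) j) - (residue 0 (x i) j + residue 0 (y i) j) \<approx>\<^sub>p 0"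
      using xy[OF i i, of 1 j] p_gt_1 by (auto simp: glue_def e_def o0_def residue_add)
    from pcong_add[OF pcong_diff[OF this yp[OF i, of j]] x0[OF i, of j]]
    have "\<phi> i j - residue 0 (y i) j \<approx>\<^sub>p 0" by (simp add: \<phi>_def algebra_simps)
    from pcong_add[OF pcong_sym[OF this] pcong_refl[of "residue 0 (y i) j"]] show ?thesis by simp
  qed
  \<comment> \<open>The subspace \<open>X * f = g\<close>.\<close>
  have shift: "(case j of 0 \<Rightarrow> 0 | Suc j' \<Rightarrow> \<phi> i j') \<approx>\<^sub>p \<phi> (Suc i) j" if i: "Suc i < n" for i j
  proof -
    have "glue (Suc p) (residue p (x i + y (Suc i))) (residue 0 (x i + y (Suc i))) j \<approx>\<^sub>p 0"
      using i p_gt_1 by (intro xy) (auto simp: glue_def e_def o0_def split: nat.split)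
    then have "(case j of 0 \<Rightarrow> 0 | Suc j' \<Rightarrow> residue p (x i) j' + residue p (y (Suc i)) j')
        - (residue 0 (x i) j + residue 0 (y (Suc i)) j) \<approx>\<^sub>p 0"
      using p_gt_1 by (simp add: glue_def residue_add cong: nat.case_cong)
    from pcong_add[OF this pcong_add[OF x0[of i j] y0[OF i, of j]]] i
    have "(case j of 0 \<Rightarrow> 0 | Suc j' \<Rightarrow> residue p (x i) j' + residue p (y (Suc i)) j') \<approx>\<^sub>p \<phi> (Suc i) j"
      by simp
    moreover have "(case j of 0 \<Rightarrow> 0 | Suc j' \<Rightarrow> \<phi> i j')
        \<approx>\<^sub>p (case j of 0 \<Rightarrow> 0 | Suc j' \<Rightarrow> residue p (x i) j' + residue p (y (Suc i)) j')"
      using pcong_add[OF pcong_refl pcong_sym[OF yp[OF i]]]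
      by (auto simp: \<phi>_def split: nat.split)
    ultimately show ?thesis by (metis pcong_trans)
  qed
  have diag: "\<phi> i j \<approx>\<^sub>p \<phi> (i + k) (j + k)" if "i + k < n" for i j k
    using that
  proof (induction k)
    case (Suc k)
    then show ?case using shift[of "i + k" "Suc (j + k)"] pcong_trans[of "\<phi> i j"] by simp
  qed simp
  define s where "s = \<phi> 0 0"
  have scalar: "\<phi> i j \<approx>\<^sub>p s * e i j" if i: "i < n" for i j
  proof -
    consider "i = j" | "j < i" | "i < j" by linarith
    then show ?thesis
    proof cases
      case 1
      then show ?thesis using diag[of 0 i 0] i pcong_sym by (simp add: s_def e_def)
    next
      case 2
      then obtain i' where i': "i = Suc i' + j" by (metis add.commute add_Suc_right less_iff_Suc_add)
      have "\<phi> (Suc i') 0 \<approx>\<^sub>p \<phi> i j" using diag[of "Suc i'" j 0] i i' by simp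
      moreover have "0 \<approx>\<^sub>p \<phi> (Suc i') 0" using shift[of i' 0] i i' by simp
      ultimately show ?thesis using 2 by (metis e_def mult_zero_right nat_neq_iff pcong_sym pcong_trans)
    next
      case 3
      have "residue p (x (n - 1)) (j + (n - 1 - i)) = 0"
        using 3 i by (intro residue_supp lat_ambient submodule_lat[OF submodule_U] x) auto
      then show ?thesis using diag[of i "n - 1 - i" j] 3 i by (simp add: \<phi>_def e_def)
    qed
  qed
  have xU: "x i \<in> ambient_K" if "i < n" for i using x(1)[OF that] submodule_lat[OF submodule_U] lat_ambient_K by blast
  have "s \<in> K" unfolding s_def \<phi>_def using n_ge_2 by (intro residue_K xU) simp
  moreover have "residue c u j \<approx>\<^sub>p s * residue c (u + w) j"
    if u: "u \<in> U" and w: "w \<in> W" and c: "c = 0 \<or> c = p" for u w c j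
  proof -
    define f g where "f = residue p (u + w)" and "g = residue 0 (u + w)"
    have uw: "u + w \<in> lat" using u w submodule_lat[OF submodule_U] submodule_lat[OF submodule_W] lat_add by blast
    have fK: "f i \<in> K" and gK: "g i \<in> K" for i
      using residue_K[OF lat_ambient_K[OF uw]] by (simp_all add: f_def g_def)
    have fs: "f i = 0" and gs: "g i = 0" if "n \<le> i" for i
      using residue_supp[OF lat_ambient[OF uw] that] by (simp_all add: f_def g_def)
    define zU where "zU = (\<Sum>i<n. seq_scale (f i) (x i) + seq_scale (g i) (y i))"
    define zW where "zW = (\<Sum>i<n. seq_scale (f i) (wx i) + seq_scale (g i) (wy i))"
    have U: "u - zU \<in> U" unfolding zU_def
      by (intro submodule_diff[OF submodule_U] u submodule_sum[OF submodule_U] submodule_add[OF submodule_U] submodule_scale[OF submodule_U] fK gK x y) auto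
    have W: "w - zW \<in> W" unfolding zW_def
      by (intro submodule_diff[OF submodule_W] w submodule_sum[OF submodule_W] submodule_add[OF submodule_W] submodule_scale[OF submodule_W] fK gK x y) auto
    have c': "c \<le> Suc p" using c by auto
    have pick: "(\<Sum>i<n. h i * e i j) = h j" if "\<And>i. n \<le> i \<Longrightarrow> h i = 0" for h j
    proof -
      have "(\<Sum>i<n. h i * e i j) = (\<Sum>i<n. if i = j then h i else 0)"
        by (intro sum.cong) (auto simp: e_def)
      then show ?thesis using that[of j] by (simp add: not_less)
    qed
    have "residue c ((u - zU) + (w - zW)) j = 0" for j
    proof -
      have "residue c zU j + residue c zW j
          = (\<Sum>i<n. f i * residue c (x i + wx i) j + g i * residue c (y i + wy i) j)"
        by (simp add: zU_def zW_def residue_sum residue_add residue_scale sum.distrib algebra_simps)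
      also have "\<dots> = (\<Sum>i<n. f i * glue c (e i) o0 j + g i * glue c o0 (e i) j)"
        using rx ry c' by (intro sum.cong) auto
      also have "\<dots> = residue c (u + w) j"
        using c pick[of f j] pick[of g j] fs gs by (auto simp: os f_def[symmetric] g_def[symmetric])
      finally show ?thesis by (simp add: residue_add residue_diff algebra_simps)
    qed
    then have "residue c (u - zU) j \<approx>\<^sub>p 0" by (intro residue_summand[OF U W c']) simp
    then have "residue c u j - residue c zU j \<approx>\<^sub>p 0" by (simp add: residue_diff)
    from pcong_add[OF this pcong_refl[of "residue c zU j"]] have "residue c u j \<approx>\<^sub>p residue c zU j" by simp
    also have "residue c zU j = (\<Sum>i<n. f i * residue c (x i) j + g i * residue c (y i) j)"
      by (simp add: zU_def residue_sum residue_add residue_scale)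
    also have "\<dots> \<approx>\<^sub>p (\<Sum>i<n. (if c = p then f i else g i) * (s * e i j))"
    proof (rule pcong_sum)
      fix i assume "i \<in> {..<n}"
      then have i: "i < n" by simp
      show "f i * residue c (x i) j + g i * residue c (y i) j \<approx>\<^sub>p (if c = p then f i else g i) * (s * e i j)"
      proof (cases "c = p")
        case True
        then show ?thesis
          using pcong_add[OF pcong_scale[OF fK[of i] scalar[OF i, of j]] pcong_scale[OF gK[of i] yp[OF i, of j]]]
          by (simp add: \<phi>_def)
      next
        case False
        then show ?thesis using c
            pcong_add[OF pcong_scale[OF fK[of i] x0[OF i, of j]]
              pcong_scale[OF gK[of i] pcong_trans[OF y0[OF i, of j] scalar[OF i, of j]]]]
          by simp
      qed
    qed
    also have "\<dots> = s * (\<Sum>i<n. (if c = p then f i else g i) * e i j)"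
      by (simp add: sum_distrib_left algebra_simps)
    also have "\<dots> = s * residue c (u + w) j"
      using c pick[of f j] pick[of g j] fs gs p_gt_0 by (auto simp: f_def[symmetric] g_def[symmetric])
    finally show ?thesis .
  qed
  ultimately show ?thesis using that by blast
qed

lemma residue_pcong_0:
  assumes "v \<in> lat" "\<And>i. residue 0 v i \<approx>\<^sub>p 0" "\<And>i. residue p v i \<approx>\<^sub>p 0" "c \<le> Suc p"
  shows "residue c v i \<approx>\<^sub>p 0"
proof -
  have "residue c v i \<approx>\<^sub>p glue c (residue p v) (residue 0 v) i" using lat_glue assms by blast
  also have "\<dots> \<approx>\<^sub>p glue c (\<lambda>_. 0) (\<lambda>_. 0) i" using assms by (intro glue_cong)
  also have "\<dots> = 0" by (simp add: glue_def split: nat.split)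
  finally show ?thesis .
qed

text \<open>The scalar of the projection is idempotent: it acts as \<open>1\<close> on the residues of \<open>U\<close> and as \<open>0\<close> on those
  of \<open>W\<close>. Since \<open>pK\<close> is prime, one of the summands has only zero residues.\<close>

lemma one_summand_trivial: "U = {0} \<or> W = {0}"
proof -
  interpret swapped: lattice_decomposition p K G \<alpha> \<beta> n W U
  proof
    show "\<exists>w\<in>W. \<exists>u\<in>U. m = w + u" if "m \<in> lat" for m
      using spans[OF that] by (metis add.commute)
  qed (use submodule_U submodule_W disjoint in auto)
  obtain s where s: "s \<in> K"
    and scalar: "\<And>u w c i. u \<in> U \<Longrightarrow> w \<in> W \<Longrightarrow> c = 0 \<or> c = p \<Longrightarrow> residue c u i \<approx>\<^sub>p s * residue c (u + w) i"
    using residue_U_scalar by blast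
  have U_residue: "(1 - s) * residue c u i \<approx>\<^sub>p 0" if "u \<in> U" "c = 0 \<or> c = p" for u c i
    using pcong_diff[OF scalar[OF that(1) submodule_0[OF submodule_W] that(2), of i] pcong_refl[of "s * residue c u i"]]
    by (simp add: algebra_simps)
  have W_residue: "s * residue c w i \<approx>\<^sub>p 0" if "w \<in> W" "c = 0 \<or> c = p" for w c i
    using pcong_sym[OF scalar[OF submodule_0[OF submodule_U] that, of i]] by simp
  show ?thesis
  proof (cases "\<forall>u\<in>U. \<forall>i. residue 0 u i \<approx>\<^sub>p 0 \<and> residue p u i \<approx>\<^sub>p 0")
    case True
    then have "U = {0}"
      by (intro summand_trivial_of_residue) (rule residue_pcong_0[OF submodule_lat[OF submodule_U]], auto)
    then show ?thesis ..
  next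
    case False
    then obtain u c i where u: "u \<in> U" "c = 0 \<or> c = p" "\<not> residue c u i \<approx>\<^sub>p 0" by blast
    have "1 - s \<approx>\<^sub>p 0"
      using pcong_0_prime[OF K_diff[OF K_1 s] residue_K U_residue[OF u(1,2), of i]] u
        submodule_lat[OF submodule_U u(1)] lat_ambient_K by blast
    have "residue c w i \<approx>\<^sub>p 0" if w: "w \<in> W" and c: "c = 0 \<or> c = p" for w c i
    proof -
      have "residue c w i \<in> K" using residue_K lat_ambient_K submodule_lat[OF submodule_W w] by blast
      from pcong_add[OF pcong_scale[OF this \<open>1 - s \<approx>\<^sub>p 0\<close>] W_residue[OF w c, of i]]
      show ?thesis by (simp add: algebra_simps)
    qed
    then have "W = {0}"
      by (intro swapped.summand_trivial_of_residue) (rule residue_pcong_0[OF submodule_lat[OF submodule_W]], auto)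
    then show ?thesis ..
  qed
qed

end


section \<open>The cocycle\<close>

context cp_cp_lattice
begin

text \<open>In the trivial component, read as polynomials of degree at most \<open>n\<close>, this is \<open>\<alpha> + \<beta> * (X^n - X)\<close>. The
  term \<open>- X\<close> makes the value at \<open>1\<close> equal to \<open>\<alpha>\<close>.\<close>

definition translation :: "'g \<Rightarrow> nat \<Rightarrow> 'f" where
  "translation g = vec (\<lambda>c i k. if c = Suc p \<and> k = 0 then
     (if i = 0 then of_nat (\<alpha> g) else if i = 1 then - of_nat (\<beta> g) else if i = n then of_nat (\<beta> g) else 0)
     else 0)"

lemma translation_ambient_K: "translation g \<in> ambient_K"
proof -
  have "translation g \<in> ambient"
    using n_ge_2 by (intro ambientI) (auto simp: translation_def)
  moreover have "translation g j \<in> K" for j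
    by (rule ix_cases[of j]) (simp add: translation_def K_0 K_of_nat K_minus)
  ultimately show ?thesis by (simp add: ambient_K_def)
qed

lemma lat_of_residue_0:
  assumes "v \<in> ambient_K" "\<And>c i. c \<le> Suc p \<Longrightarrow> residue c v i \<approx>\<^sub>p 0"
  shows "v \<in> lat"
proof (rule latI[OF assms(1)])
  fix c i assume c: "c \<le> Suc p"
  have "glue c (residue p v) (residue 0 v) i \<approx>\<^sub>p glue c (\<lambda>_. 0) (\<lambda>_. 0) i"
    using assms(2) by (intro glue_cong) simp_all
  also have "\<dots> = 0" by (simp add: glue_def split: nat.split)
  finally show "residue c v i \<approx>\<^sub>p glue c (residue p v) (residue 0 v) i"
    using assms(2)[OF c] by (metis pcong_sym pcong_trans)
qed

lemma of_nat_mod_pcong: "of_nat (m mod p) \<approx>\<^sub>p of_nat m"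
proof -
  have "of_nat (m mod p) - of_nat m = of_nat p * (- of_nat (m div p) :: 'f)"
  proof -
    have "(of_nat p * of_nat (m div p) + of_nat (m mod p) :: 'f) = of_nat m"
      by (metis mult_div_mod_eq of_nat_add of_nat_mult)
    then show ?thesis by (simp only: mult_minus_right eq_diff_eq diff_conv_add_uminus) (simp add: algebra_simps)
  qed
  then show ?thesis unfolding pcong_def using K_minus[OF K_of_nat] by blast
qed

lemma translation_mult:
  assumes "g \<in> carrier G" "h \<in> carrier G"
  shows "translation (g \<otimes> h) - (translation g + translation h) \<in> lat"
proof (rule lat_of_residue_0)
  show "translation (g \<otimes> h) - (translation g + translation h) \<in> ambient_K"
    by (intro ambient_K_diff ambient_K_add translation_ambient_K)
  fix c i
  have "of_nat (\<alpha> (g \<otimes> h)) - (of_nat (\<alpha> g) + of_nat (\<alpha> h)) \<approx>\<^sub>p 0"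
    and \<beta>: "of_nat (\<beta> (g \<otimes> h)) - (of_nat (\<beta> g) + of_nat (\<beta> h)) \<approx>\<^sub>p 0"
    using pcong_diff[OF of_nat_mod_pcong[of "\<alpha> g + \<alpha> h"] pcong_refl[of "of_nat (\<alpha> g + \<alpha> h)"]]
      pcong_diff[OF of_nat_mod_pcong[of "\<beta> g + \<beta> h"] pcong_refl[of "of_nat (\<beta> g + \<beta> h)"]] assms
    by (simp_all add: \<alpha>_mult \<beta>_mult)
  then show "residue c (translation (g \<otimes> h) - (translation g + translation h)) i \<approx>\<^sub>p 0"
    using pcong_minus[OF \<beta>] by (auto simp: residue_def translation_def algebra_simps)
qed

lemma \<chi>_vanishes:
  assumes g: "g \<in> carrier G" and "\<alpha> g \<noteq> 0"
  obtains c where "c < p" "\<chi> c g = 0"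
proof -
  have "\<not> p dvd \<alpha> g" using \<alpha>_less[OF g] assms(2) by (auto dest: dvd_imp_le)
  then have "\<not> int p dvd int (\<alpha> g)" by simp
  then obtain b d where bd: "int (\<alpha> g) * b = 1 + int p * d"
    using prime_inverse_mod[OF prime_p] by blast
  define c where "c = nat ((- int (\<beta> g) * b) mod int p)"
  have c: "int c = (- int (\<beta> g) * b) mod int p" using p_gt_0 by (simp add: c_def)
  have "int ((\<beta> g + c * \<alpha> g) mod p) = (int (\<beta> g) + int c * int (\<alpha> g)) mod int p"
    by (simp add: zmod_int)
  also have "\<dots> = (int (\<beta> g) + (- int (\<beta> g) * b) * int (\<alpha> g)) mod int p"
    unfolding c by (rule mod_add_cong) (simp_all only: mod_mult_left_eq)
  also have "int (\<beta> g) + (- int (\<beta> g) * b) * int (\<alpha> g) = - int (\<beta> g) * d * int p"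
  proof -
    have "(- int (\<beta> g) * b) * int (\<alpha> g) = - int (\<beta> g) * (int (\<alpha> g) * b)" by simp
    then show ?thesis unfolding bd by (simp add: algebra_simps)
  qed
  finally have "(\<beta> g + c * \<alpha> g) mod p = 0" by simp
  moreover have "c < p" using c p_gt_0 by (metis of_nat_0_less_iff of_nat_less_iff pos_mod_bound)
  ultimately show ?thesis using that[of c] by (simp add: \<chi>_def)
qed

text \<open>Let \<open>\<chi> c g = 0\<close>. The residue of \<open>m\<close> in the component \<open>c\<close> vanishes. For the residues \<open>f\<close> and \<open>h\<close> in the
  components \<open>p\<close> and \<open>0\<close> this means \<open>f = 0\<close> if \<open>c = p\<close>, \<open>f = h\<close> if \<open>c = 1\<close>,
  and \<open>h = 0\<close> otherwise. The translation part is congruent to \<open>h - X * f\<close>, so its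
  coefficient at \<open>X^n\<close>, its value at \<open>1\<close>, or its constant coefficient is divisible by \<open>p\<close>, respectively. These
  numbers are \<open>\<beta> g\<close>, \<open>\<alpha> g\<close> and \<open>\<alpha> g\<close>. The case \<open>c = p\<close> arises precisely if \<open>\<alpha> g = 0\<close>.\<close>

lemma translation_not_fixed:
  assumes g: "g \<in> carrier G" and m: "m \<in> lat"
    and triv: "\<And>i. (translation g + m) (ix (Suc p) i 0) = 0"
    and fixed: "\<And>c i k. c \<le> p \<Longrightarrow> \<chi> c g = 0 \<Longrightarrow> (translation g + m) (ix c i k) = 0"
  shows "g = \<one>"
proof -
  define f h where "f = residue p m" and "h = residue 0 m"
  have fs: "f i = 0" and hs: "h i = 0" if "n \<le> i" for i
    using residue_supp[OF lat_ambient[OF m] that] by (simp_all add: f_def h_def)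
  have residue_fixed: "residue c m i = 0" if "c \<le> p" "\<chi> c g = 0" for c i
    using fixed[OF that] that(1) by (simp add: residue_def translation_def)
  have tr: "translation g (ix (Suc p) i 0) \<approx>\<^sub>p h i - (case i of 0 \<Rightarrow> 0 | Suc j \<Rightarrow> f j)" for i
  proof -
    have "m (ix (Suc p) i 0) \<approx>\<^sub>p (case i of 0 \<Rightarrow> 0 | Suc j \<Rightarrow> f j) - h i"
    proof -
      have "residue (Suc p) m i = m (ix (Suc p) i 0)" by (simp add: residue_def)
      then show ?thesis
        using lat_glue[OF m, of "Suc p" i] p_gt_1 unfolding f_def h_def by (simp add: glue_def)
    qed
    from pcong_minus[OF this] show ?thesis
      using triv[of i] by (simp add: eq_neg_iff_add_eq_0[symmetric])
  qed
  have small: "a = 0" if "of_nat a \<approx>\<^sub>p 0" "a < p" for a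
    using that by (auto simp: pcong_of_nat_0 dest: dvd_imp_le)
  have \<alpha>0: "\<alpha> g = 0"
  proof (rule ccontr)
    assume "\<alpha> g \<noteq> 0"
    then obtain c where c: "c < p" "\<chi> c g = 0" using \<chi>_vanishes[OF g] by blast
    have residue_c: "glue c f h i \<approx>\<^sub>p 0" for i
      using lat_glue[OF m, of c i] residue_fixed[of c i] c pcong_sym by (simp add: f_def h_def)
    have "of_nat (\<alpha> g) \<approx>\<^sub>p 0"
    proof (cases "c = 1")
      case True
      then have fh: "f i - h i \<approx>\<^sub>p 0" for i using residue_c[of i] c by (simp add: glue_def)
      obtain l where l: "n = Suc l" using n_ge_2 by (cases n) auto
      have "of_nat (\<alpha> g) = (\<Sum>i\<le>n. translation g (ix (Suc p) i 0))"
      proof -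
        have "(\<Sum>i\<le>n. translation g (ix (Suc p) i 0)) = (\<Sum>i\<le>n. (if i = 0 then of_nat (\<alpha> g) else 0)
          + ((if i = 1 then - of_nat (\<beta> g) else 0) + (if i = n then of_nat (\<beta> g) else 0)))"
          using n_ge_2 by (intro sum.cong) (auto simp: translation_def)
        then show ?thesis using n_ge_2 by (simp add: sum.distrib)
      qed
      also have "\<dots> \<approx>\<^sub>p (\<Sum>i\<le>n. h i - (case i of 0 \<Rightarrow> 0 | Suc j \<Rightarrow> f j))"
        by (intro pcong_sum tr)
      also have "\<dots> = (\<Sum>i\<le>l. - (f i - h i))"
      proof -
        have "(\<Sum>i\<le>n. case i of 0 \<Rightarrow> 0 | Suc j \<Rightarrow> f j) = (\<Sum>i\<le>l. f i)"
          unfolding l by (subst sum.atMost_Suc_shift) simp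
        moreover have "(\<Sum>i\<le>n. h i) = (\<Sum>i\<le>l. h i)" using hs[of n] by (simp add: l)
        ultimately show ?thesis by (simp add: sum_subtractf)
      qed
      also have "\<dots> \<approx>\<^sub>p (\<Sum>i\<le>l. - 0)" by (intro pcong_sum pcong_minus fh)
      finally show ?thesis by simp
    next
      case False
      then have "h 0 \<approx>\<^sub>p 0" using residue_c[of 0] c by (simp add: glue_def)
      then show ?thesis using tr[of 0] pcong_trans by (simp add: translation_def)
    qed
    then show False using small[of "\<alpha> g"] \<alpha>_less[OF g] \<open>\<alpha> g \<noteq> 0\<close> by simp
  qed
  have "f i = 0" for i
    using residue_fixed[of p i] \<alpha>0 by (simp add: f_def \<chi>_def)
  then have "of_nat (\<beta> g) \<approx>\<^sub>p 0"
    using tr[of n] hs[of n] n_ge_2 by (simp add: translation_def split: nat.splits)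
  then have \<beta>0: "\<beta> g = 0" using small \<beta>_less[OF g] by blast
  have "\<alpha> \<one> = 0" "\<beta> \<one> = 0"
    using \<chi>_one[of p] \<chi>_one[of 0] \<beta>_less[of \<one>] p_gt_0 by (simp_all add: \<chi>_def)
  then show ?thesis using coords_inj[OF g] \<alpha>0 \<beta>0 by simp
qed

end


section \<open>The crystallographic groups\<close>

context cp_cp_lattice
begin

text \<open>The entries at the positions \<open>k \<ge> 1\<close> determine a function with sum zero. They serve as coordinates
  for the lattice.\<close>

definition coordinate_set :: "nat set" where
  "coordinate_set = (\<lambda>(c, i, k). ix c i k) ` ({..p} \<times> {..<n} \<times> {1..<p} \<union> {Suc p} \<times> {..n} \<times> {0})"

lemma coordinate_set_cases:
  assumes "j \<in> coordinate_set"
  obtains c i k where "j = ix c i k" "c \<le> p" "i < n" "1 \<le> k" "k < p"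
  | i where "j = ix (Suc p) i 0" "i \<le> n"
  using assms by (auto simp: coordinate_set_def)

lemma lat_determined:
  assumes v: "v \<in> lat" and zero: "\<And>j. j \<in> coordinate_set \<Longrightarrow> v j = 0"
  shows "v = 0"
proof (rule vec_eqI)
  fix c i k
  have outside: "v (ix c i k) = 0" if "\<not> (c \<le> p \<and> i < n \<and> k < p \<or> c = Suc p \<and> i \<le> n \<and> k = 0)" for c i k
    using ambient_supp[OF lat_ambient[OF v] that] .
  have pos: "v (ix c i k) = 0" if "0 < k \<or> p < c" for c i k
  proof (cases "c \<le> p \<and> i < n \<and> k < p \<or> c = Suc p \<and> i \<le> n \<and> k = 0")
    case True
    then have "ix c i k \<in> coordinate_set"
      using that by (force simp: coordinate_set_def)
    then show ?thesis by (rule zero)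
  qed (rule outside)
  have "v (ix c i 0) = 0" if "c \<le> p"
  proof -
    have "(\<Sum>k<p. v (ix c i k)) = v (ix c i 0)"
      using sum_first_two[OF p_gt_1, of "\<lambda>k. v (ix c i k)"] pos by simp
    then show ?thesis using ambient_sum[OF lat_ambient[OF v] that] by simp
  qed
  then show "v (ix c i k) = 0 (ix c i k)"
    using pos[of k c i] by (cases "k = 0"; cases "c \<le> p") auto
qed

lemma lat_p_vector:
  assumes "j \<in> coordinate_set"
  shows "\<exists>v\<in>lat. v j = of_nat p \<and> (\<forall>i\<in>coordinate_set - {j}. v i = 0)"
  using assms
proof (cases rule: coordinate_set_cases)
  case (1 c i k)
  define w :: "nat \<Rightarrow> 'f" where
    "w = vec (\<lambda>c' i' k'. if c' = c \<and> i' = i then (if k' = k then 1 else 0) + (if k' = 0 then - 1 else 0) else 0)"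
  have "w \<in> ambient"
  proof (rule ambientI)
    fix c' i' assume "c' \<le> p"
    show "(\<Sum>k<p. w (ix c' i' k)) = 0"
    proof (cases "c' = c \<and> i' = i")
      case True
      then show ?thesis using 1 p_gt_0 by (simp add: w_def sum.distrib)
    next
      case False
      then show ?thesis by (intro sum.neutral) (auto simp: w_def)
    qed
  qed (use 1 p_gt_0 in \<open>auto simp: w_def\<close>)
  moreover have "w j' \<in> K" for j'
    by (rule ix_cases[of j']) (simp add: w_def K_0 K_1 K_minus K_add)
  ultimately have "seq_scale (of_nat p) w \<in> lat" by (intro p_ambient_K_lat) (simp add: ambient_K_def)
  moreover have "w j = 1" using 1 by (simp add: w_def)
  moreover have "w j' = 0" if "j' \<in> coordinate_set - {j}" for j'
    using that 1 by (auto simp: coordinate_set_def w_def)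
  ultimately show ?thesis by (intro bexI[of _ "seq_scale (of_nat p) w"]) simp_all
next
  case (2 i)
  define w :: "nat \<Rightarrow> 'f" where "w = vec (\<lambda>c' i' k'. if c' = Suc p \<and> i' = i \<and> k' = 0 then 1 else 0)"
  have "w \<in> ambient" by (rule ambientI) (use 2 in \<open>auto simp: w_def\<close>)
  moreover have "w j' \<in> K" for j'
    by (rule ix_cases[of j']) (simp add: w_def K_0 K_1)
  ultimately have "seq_scale (of_nat p) w \<in> lat" by (intro p_ambient_K_lat) (simp add: ambient_K_def)
  moreover have "w j = 1" using 2 by (simp add: w_def)
  moreover have "w j' = 0" if "j' \<in> coordinate_set - {j}" for j'
    using that 2 by (auto simp: coordinate_set_def w_def)
  ultimately show ?thesis by (intro bexI[of _ "seq_scale (of_nat p) w"]) simp_all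
qed

lemma finite_coordinate_set: "finite coordinate_set"
  by (simp add: coordinate_set_def)

lemma lat_basis: "\<exists>B. lattice_basis seq_scale K lat B \<and> card B = card coordinate_set"
  by (rule lattice_basis_of_coordinates[OF finite_coordinate_set lat_0 lat_add lat_scale])
    (blast intro: lat_K lat_determined lat_p_vector)+

lemma lat_rank: "n < lattice_rank seq_scale K lat"
proof -
  have "(\<lambda>i. ix (Suc p) i 0) ` {..n} \<subseteq> coordinate_set"
    by (force simp: coordinate_set_def)
  then have "card ((\<lambda>i. ix (Suc p) i 0) ` {..n}) \<le> card coordinate_set"
    by (rule card_mono[OF finite_coordinate_set])
  then have "n < card coordinate_set"
    by (simp add: card_image inj_on_def)
  then show ?thesis using lat_basis lattice_rank_eq_card[OF K_0 K_1] by metis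
qed

abbreviation FM :: "(nat \<Rightarrow> 'f) set" where
  "FM \<equiv> scalar_ext seq_scale lat"

text \<open>The restriction makes the operators elements of the symmetric group of \<open>FM\<close>.\<close>

definition lattice_op :: "'g \<Rightarrow> (nat \<Rightarrow> 'f) \<Rightarrow> nat \<Rightarrow> 'f" where
  "lattice_op g = restrict (act g) FM"

lemma lat_FM: "v \<in> lat \<Longrightarrow> v \<in> FM"
  by (rule seq.span_base)

lemma act_FM: assumes g: "g \<in> carrier G" and v: "v \<in> FM" shows "act g v \<in> FM"
proof -
  have "FM \<subseteq> {v. act g v \<in> FM}"
  proof (rule seq.span_minimal)
    show "lat \<subseteq> {v. act g v \<in> FM}" using lat_act[OF g] lat_FM by blast
    show "seq.subspace {v. act g v \<in> FM}"
      by (rule seq.subspaceI)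
        (simp_all add: seq.span_zero act_add seq.span_add act_scale seq.span_scale)
  qed
  then show ?thesis using v by blast
qed

lemma group_action_restrict:
  assumes E: "\<And>g v. g \<in> carrier G \<Longrightarrow> v \<in> E \<Longrightarrow> act g v \<in> E"
  shows "group_action G E (\<lambda>g. restrict (act g) E)"
proof -
  have bij: "restrict (act g) E \<in> Bij E" if g: "g \<in> carrier G" for g
  proof -
    have "bij_betw (act g) E E"
      by (rule bij_betw_byWitness[where f' = "act (inv g)"]) (use g E act_inv in auto)
    then show ?thesis by (simp add: Bij_def cong: bij_betw_cong)
  qed
  have "restrict (act (g \<otimes> h)) E = compose E (restrict (act g) E) (restrict (act h) E)"
    if "g \<in> carrier G" "h \<in> carrier G" for g h
    using that E by (auto simp: compose_def restrict_def act_mult)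
  then have "(\<lambda>g. restrict (act g) E) \<in> hom G (BijGroup E)"
    using bij by (auto simp: hom_def BijGroup_def)
  then show ?thesis
    unfolding group_action_def group_hom_def group_hom_axioms_def
    using group_BijGroup is_group by blast
qed

lemma act_faithful:
  assumes g: "g \<in> carrier G" and h: "h \<in> carrier G" and eq: "\<And>v. v \<in> lat \<Longrightarrow> act g v = act h v"
  shows "g = h"
proof -
  have \<chi>_eq: "\<chi> c g = \<chi> c h" if c: "c \<le> p" for c
  proof -
    \<comment> \<open>In the copy \<open>0\<close> of the component \<open>c\<close>, the entry \<open>- p\<close> of \<open>w\<close> occurs at one position only.\<close>
    define w where "w = seq_scale (of_nat p) (with_residues (\<lambda>_ _. 1))"
    have "w \<in> lat" unfolding w_def by (intro p_ambient_K_lat with_residues_ambient_K K_1)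
    then have "act g w = act h w" by (rule eq)
    moreover define k where "k = (p - \<chi> c g) mod p"
    have "k < p" using p_gt_0 by (simp add: k_def)
    moreover have "(k + \<chi> c g) mod p = 0"
      using \<chi>_less[OF g, of c] by (simp add: k_def mod_simps)
    ultimately have "w (ix c 0 ((k + \<chi> c h) mod p)) = w (ix c 0 0)"
      by (metis act_ix)
    moreover have "w (ix c 0 0) = - of_nat p" "w (ix c 0 j) = of_nat p \<or> w (ix c 0 j) = 0" if "j \<noteq> 0" for j
      using that c n_ge_2 by (auto simp: w_def with_residues_def)
    moreover have "- of_nat p \<noteq> (0::'f)" "- of_nat p \<noteq> (of_nat p :: 'f)"
      using p_nonzero char_0[of "p + p"] p_gt_0 by (auto simp: eq_commute[of "- of_nat p"] eq_neg_iff_add_eq_0)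
    ultimately have "(k + \<chi> c h) mod p = 0" by metis
    then have "(k + \<chi> c h) mod p = (k + \<chi> c g) mod p" using \<open>(k + \<chi> c g) mod p = 0\<close> by simp
    then have "int p dvd (int k + int (\<chi> c h)) - (int k + int (\<chi> c g))"
      by (metis mod_eq_dvd_iff of_nat_add zmod_int)
    then have "int (\<chi> c h) mod int p = int (\<chi> c g) mod int p" by (simp add: mod_eq_dvd_iff)
    then show ?thesis using \<chi>_less[OF g, of c] \<chi>_less[OF h, of c] by simp
  qed
  show ?thesis
    using \<chi>_eq[of p] \<chi>_eq[of 0] \<beta>_less[OF g] \<beta>_less[OF h] p_gt_0
    by (intro coords_inj g h) (simp_all add: \<chi>_def)
qed

lemma faithful_lattice_lat: "faithful_lattice seq_scale K G lat lattice_op"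
proof -
  have lattice_op_lat: "restrict (lattice_op g) lat = restrict (act g) lat" for g
    using lat_FM by (auto simp: lattice_op_def restrict_def)
  have "faithful_action G lat (\<lambda>g. restrict (lattice_op g) lat)"
    unfolding lattice_op_lat
  proof (intro faithful_action.intro faithful_action_axioms.intro group_action_restrict lat_act)
    show "inj_on (\<lambda>g. restrict (act g) lat) (carrier G)"
    proof (rule inj_onI)
      fix g h assume gh: "g \<in> carrier G" "h \<in> carrier G" "restrict (act g) lat = restrict (act h) lat"
      then have "act g v = act h v" if "v \<in> lat" for v
        using that by (metis restrict_apply')
      then show "g = h" using act_faithful gh by blast
    qed
  qed
  moreover have "group_action G FM lattice_op"
    using group_action_restrict[of FM] act_FM unfolding lattice_op_def by blast
  moreover have "subring K ring_of_type_algebra"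
  proof -
    interpret R: ring "ring_of_type_algebra :: 'f ring" ..
    show ?thesis
    proof (rule R.subringI)
      fix x assume "x \<in> K"
      moreover have "\<ominus>\<^bsub>ring_of_type_algebra\<^esub> x = - x"
        by (rule R.minus_equality) (simp_all add: ring_of_type_algebra_def)
      ultimately show "\<ominus>\<^bsub>ring_of_type_algebra\<^esub> x \<in> K" using K_minus by simp
    qed (auto simp: ring_of_type_algebra_def K_1 K_mult K_add)
  qed
  moreover have "lattice_op g (v + w) = lattice_op g v + lattice_op g w" "lattice_op g (seq_scale c v) = seq_scale c (lattice_op g v)"
    if "v \<in> FM" "w \<in> FM" for g v w c
    using seq.span_add[OF that] seq.span_scale[OF that(1)] that
    by (simp_all only: lattice_op_def restrict_apply' act_add act_scale)
  moreover have "\<exists>B. lattice_basis seq_scale K lat B" using lat_basis by blast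
  ultimately show ?thesis
    using finite_G
    by (intro faithful_lattice.intro faithful_lattice_axioms.intro vector_space_seq_scale is_group) blast+
qed

definition cocycle :: "'g \<Rightarrow> (nat \<Rightarrow> 'f) set" where
  "cocycle g = (\<lambda>m. translation g + m) ` lat"

lemma translation_FM: "translation g \<in> FM"
proof -
  have "seq_scale (inverse (of_nat p)) (seq_scale (of_nat p) (translation g)) \<in> FM"
    by (intro seq.span_scale lat_FM p_ambient_K_lat translation_ambient_K)
  then show ?thesis using p_nonzero by simp
qed

lemma cocycle_FM: "z \<in> cocycle g \<Longrightarrow> z \<in> FM"
  unfolding cocycle_def using translation_FM lat_FM seq.span_add by blast

lemma group_additive_FM: "group (additive_group FM)"
proof (rule groupI)
  fix x assume x: "x \<in> carrier (additive_group FM)"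
  then show "\<exists>y\<in>carrier (additive_group FM). y \<otimes>\<^bsub>additive_group FM\<^esub> x = \<one>\<^bsub>additive_group FM\<^esub>"
    using seq.span_neg[of x lat] by (intro bexI[of _ "- x"]) (auto simp: additive_group_def)
qed (auto simp: additive_group_def seq.span_zero seq.span_add add.assoc)

lemma inv_additive_FM: "v \<in> FM \<Longrightarrow> inv\<^bsub>additive_group FM\<^esub> v = - v"
  using seq.span_neg[of v lat]
  by (intro group.inv_equality[OF group_additive_FM]) (auto simp: additive_group_def)

lemma normal_lat: "lat \<lhd> additive_group FM"
proof -
  interpret A: comm_group "additive_group FM"
    by (rule group.group_comm_groupI[OF group_additive_FM]) (simp add: additive_group_def add.commute)
  have "subgroup lat (additive_group FM)"
  proof (rule A.subgroupI)
    fix v assume "v \<in> lat"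
    then show "inv\<^bsub>additive_group FM\<^esub> v \<in> lat"
      using inv_additive_FM[OF lat_FM] lat_diff[OF lat_0] by simp
  qed (use lat_0 lat_FM lat_add in \<open>auto simp: additive_group_def\<close>)
  then show ?thesis by (rule A.subgroup_imp_normal)
qed

lemma one_cocycle_cocycle: "one_cocycle seq_scale G lat lattice_op cocycle"
  unfolding one_cocycle_def
proof (intro conjI ballI Pi_I)
  fix g
  have "cocycle g = lat #>\<^bsub>additive_group FM\<^esub> translation g"
    by (auto simp: cocycle_def r_coset_def additive_group_def add.commute)
  then show "cocycle g \<in> carrier (scalar_ext_mod seq_scale lat)"
    using translation_FM[of g]
    by (auto simp: scalar_ext_mod_def FactGroup_def RCOSETS_def additive_group_def)
next
  fix g h assume g: "g \<in> carrier G" and h: "h \<in> carrier G"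
  have tr: "act g (translation h) = translation h"
  proof (rule vec_eqI)
    fix c i k show "act g (translation h) (ix c i k) = translation h (ix c i k)"
      by (cases "c \<le> p") (auto simp: translation_def act_def \<chi>_def)
  qed
  have "lattice_op g ` cocycle h = cocycle h"
  proof -
    have "lattice_op g ` cocycle h = act g ` cocycle h"
      using cocycle_FM[of _ h] by (intro image_cong) (auto simp: lattice_op_def)
    also have "\<dots> = (\<lambda>m. translation h + act g m) ` lat"
      by (simp add: cocycle_def image_image act_add tr)
    also have "\<dots> = (\<lambda>m. translation h + m) ` (act g ` lat)"
      by (simp add: image_image)
    also have "act g ` lat = lat"
    proof
      show "act g ` lat \<subseteq> lat" using lat_act[OF g] by blast
      show "lat \<subseteq> act g ` lat"
        using act_inv(1)[OF g] lat_act[OF inv_closed[OF g]] by (metis image_eqI subsetI)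
    qed
    finally show ?thesis unfolding cocycle_def[symmetric] .
  qed
  moreover have "cocycle (g \<otimes> h) = cocycle h <#>\<^bsub>additive_group FM\<^esub> cocycle g"
  proof (intro equalityI subsetI)
    fix z assume "z \<in> cocycle (g \<otimes> h)"
    then obtain m where m: "m \<in> lat" "z = translation (g \<otimes> h) + m" by (auto simp: cocycle_def)
    have "z = (translation h + 0) + (translation g + ((translation (g \<otimes> h) - (translation g + translation h)) + m))"
      using m by simp
    moreover have "(translation (g \<otimes> h) - (translation g + translation h)) + m \<in> lat"
      by (intro lat_add translation_mult g h m)
    ultimately show "z \<in> cocycle h <#>\<^bsub>additive_group FM\<^esub> cocycle g"
      using lat_0 unfolding cocycle_def set_mult_def additive_group_def by fastforce
  next
    fix z assume "z \<in> cocycle h <#>\<^bsub>additive_group FM\<^esub> cocycle g"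
    then obtain m m' where m: "m \<in> lat" "m' \<in> lat" "z = (translation h + m) + (translation g + m')"
      by (auto simp: cocycle_def set_mult_def additive_group_def)
    have "z = translation (g \<otimes> h) + ((m + m') - (translation (g \<otimes> h) - (translation g + translation h)))"
      using m by (simp add: algebra_simps)
    moreover have "(m + m') - (translation (g \<otimes> h) - (translation g + translation h)) \<in> lat"
      by (intro lat_add lat_diff translation_mult g h m)
    ultimately show "z \<in> cocycle (g \<otimes> h)" unfolding cocycle_def by blast
  qed
  ultimately show "cocycle (g \<otimes> h) = lattice_op g ` cocycle h \<otimes>\<^bsub>scalar_ext_mod seq_scale lat\<^esub> cocycle g"
    by (simp add: scalar_ext_mod_def FactGroup_def)
qed

text \<open>The common reason for the absence of torsion and for the cocycle not to be a coboundary.\<close>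

lemma cocycle_not_fixed:
  assumes g: "g \<in> carrier G" and z: "z \<in> cocycle g"
    and zero: "\<And>c i k. c \<le> Suc p \<Longrightarrow> \<chi> c g = 0 \<Longrightarrow> z (ix c i k) = 0"
  shows "g = \<one>"
proof -
  obtain m where m: "m \<in> lat" "z = translation g + m" using z by (auto simp: cocycle_def)
  show ?thesis
    by (rule translation_not_fixed[OF g m(1)])
      (simp_all only: m(2)[symmetric], auto intro: zero simp: \<chi>_def)
qed

text \<open>The value at \<open>g\<close> of a coboundary contains a vector \<open>g a - a\<close>, and this vanishes on all components that
  \<open>g\<close> fixes.\<close>

lemma not_coboundary: "\<not> one_coboundary seq_scale G lat lattice_op cocycle"
proof
  assume "one_coboundary seq_scale G lat lattice_op cocycle"
  then obtain Z where Z: "Z \<in> carrier (additive_group FM Mod lat)"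
    and T: "\<And>g. g \<in> carrier G \<Longrightarrow> cocycle g = (lattice_op g ` Z) \<otimes>\<^bsub>additive_group FM Mod lat\<^esub> inv\<^bsub>additive_group FM Mod lat\<^esub> Z"
    unfolding one_coboundary_def scalar_ext_mod_def by blast
  obtain a where a: "a \<in> FM" "Z = lat #>\<^bsub>additive_group FM\<^esub> a"
    using Z by (auto simp: FactGroup_def RCOSETS_def additive_group_def)
  have aZ: "a \<in> Z" using a lat_0 by (force simp: r_coset_def additive_group_def)
  have "- a \<in> inv\<^bsub>additive_group FM Mod lat\<^esub> Z"
    using aZ inv_additive_FM[OF a(1)]
    by (force simp: normal.inv_FactGroup[OF normal_lat Z] SET_INV_def)
  then have in_T: "act g a - a \<in> cocycle g" if g: "g \<in> carrier G" for g
  proof -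
    have "act g a \<in> lattice_op g ` Z" using aZ a by (force simp: lattice_op_def)
    then have "act g a + - a \<in> cocycle g"
      unfolding T[OF g] using \<open>- a \<in> inv\<^bsub>additive_group FM Mod lat\<^esub> Z\<close>
      by (force simp: FactGroup_def set_mult_def additive_group_def)
    then show ?thesis by simp
  qed
  obtain g where g: "g \<in> carrier G" "\<alpha> g = 1" using coords_surj[of 1 0] p_gt_1 by auto
  have "g = \<one>"
    by (rule cocycle_not_fixed[OF g(1) in_T[OF g(1)]]) (simp add: act_def)
  then show False using g \<chi>_one[of p] by (simp add: \<chi>_def)
qed

lemma Crys_pow:
  assumes g: "g \<in> carrier G" and z: "z \<in> FM"
  shows "(g, z) [^]\<^bsub>Crys G lattice_op cocycle\<^esub> (m::nat) = (g [^] m, \<Sum>k<m. act (g [^] k) z)"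
proof (induction m)
  case 0
  show ?case by (simp add: nat_pow_def Crys_def zero_fun_def)
next
  case (Suc m)
  have "(g, z) [^]\<^bsub>Crys G lattice_op cocycle\<^esub> Suc m
      = (g, z) [^]\<^bsub>Crys G lattice_op cocycle\<^esub> m \<otimes>\<^bsub>Crys G lattice_op cocycle\<^esub> (g, z)"
    by (simp add: nat_pow_def)
  also have "\<dots> = (g [^] m \<otimes> g, act (g [^] m) z + (\<Sum>k<m. act (g [^] k) z))"
    unfolding Suc using z by (simp only: Crys_def lattice_op_def monoid.simps prod.case restrict_apply' split_beta fst_conv snd_conv)
  also have "\<dots> = (g [^] Suc m, \<Sum>k<Suc m. act (g [^] k) z)"
    unfolding sum.lessThan_Suc nat_pow_Suc by (simp only: add.commute)
  finally show ?case .
qed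

text \<open>On a component fixed by \<open>g\<close>, the translation part of the \<open>m\<close>-th power of \<open>(g, z)\<close> is \<open>m\<close> times that of
  \<open>z\<close>. So an element of finite order has \<open>z = 0\<close> on these components.\<close>

lemma torsionfree_Crys: "torsionfree (Crys G lattice_op cocycle)"
  unfolding torsionfree_def
proof (intro ballI allI impI)
  fix x and m :: nat
  assume "x \<in> carrier (Crys G lattice_op cocycle)"
    and pow: "m > 0 \<and> x [^]\<^bsub>Crys G lattice_op cocycle\<^esub> m = \<one>\<^bsub>Crys G lattice_op cocycle\<^esub>"
  then obtain g z where x: "x = (g, z)" and g: "g \<in> carrier G" and z: "z \<in> cocycle g"
    by (auto simp: Crys_def)
  have "(\<Sum>k<m. act (g [^] k) z) = 0"
    using pow Crys_pow[OF g cocycle_FM[OF z], of m] by (simp add: x Crys_def)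
  then have sum: "(\<Sum>k<m. act (g [^] k) z j) = 0" for j
    by (metis sum_fun_apply zero_fun_apply)
  have zero: "z (ix c i k) = 0" if "\<chi> c g = 0" for c i k
  proof -
    have "of_nat m * z (ix c i k) = 0"
      using sum[of "ix c i k"] that g by (simp add: act_ix_trivial \<chi>_pow)
    then show ?thesis using char_0[of m] pow by auto
  qed
  then have one: "g = \<one>" using cocycle_not_fixed[OF g z] by blast
  have "z = 0"
    by (rule vec_eqI) (simp add: zero one)
  then show "x = \<one>\<^bsub>Crys G lattice_op cocycle\<^esub>" by (simp add: x one Crys_def)
qed

lemma indecomposable_lat: "indecomposable_lattice seq_scale K G lat lattice_op"
  unfolding indecomposable_lattice_def
proof (intro conjI allI impI)
  have "ix (Suc p) 0 0 \<in> coordinate_set" by (force simp: coordinate_set_def)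
  then obtain v where "v \<in> lat" "v (ix (Suc p) 0 0) = of_nat p" using lat_p_vector by blast
  then show "lat \<noteq> {0}" using p_nonzero by auto
next
  fix U W
  assume *: "kg_submodule seq_scale K G lat lattice_op U \<and> kg_submodule seq_scale K G lat lattice_op W \<and>
    U \<inter> W = {0} \<and> U <#>\<^bsub>additive_group lat\<^esub> W = lat"
  have submodule: "submodule V" if V: "kg_submodule seq_scale K G lat lattice_op V" for V
  proof -
    have V_lat: "V \<subseteq> lat" and "0 \<in> V" and "\<And>u v. u \<in> V \<Longrightarrow> v \<in> V \<Longrightarrow> u + v \<in> V"
      using V subgroup.subset subgroup.one_closed subgroup.m_closed
      unfolding kg_submodule_def additive_group_def by fastforce+
    moreover have "lattice_op g u = act g u" if "u \<in> V" for g u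
      using that V_lat lat_FM by (auto simp: lattice_op_def)
    ultimately show ?thesis using V unfolding submodule_def kg_submodule_def by auto
  qed
  have "\<exists>u\<in>U. \<exists>w\<in>W. m = u + w" if "m \<in> lat" for m
  proof -
    have "m \<in> U <#>\<^bsub>additive_group lat\<^esub> W" using * that by simp
    then show ?thesis by (auto simp: set_mult_def additive_group_def)
  qed
  then interpret lattice_decomposition p K G \<alpha> \<beta> n U W
    using * submodule by unfold_locales auto
  show "U = {0} \<or> W = {0}" by (rule one_summand_trivial)
qed

end

theorem theorem2:
  fixes p :: nat
    and K :: "'f::field set"
    and G :: "('g, 'b) monoid_scheme"
  assumes "Factorial_Ring.prime p"
    and "subring K ring_of_type_algebra"
    and "induced_ring K \<simeq> \<Z> \<or> induced_ring K \<simeq> localized_int_ring p \<or>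
         induced_ring K \<simeq> padic_int_ring p"
    and "group G"
    and "G \<cong> integer_mod_group p \<times>\<times> integer_mod_group p"
  shows "\<forall>N. \<exists>(M :: (nat \<Rightarrow> 'f) set) \<rho> T.
           faithful_lattice seq_scale K G M \<rho> \<and>
           one_cocycle seq_scale G M \<rho> T \<and>
           indecomposable_crys seq_scale K G M \<rho> T \<and>
           torsionfree (Crys G \<rho> T) \<and>
           lattice_rank seq_scale K M > N"
proof
  fix N :: nat
  have p: "p > 0" using assms(1) by (rule prime_gt_0_nat)
  have local: "p_local_domain p K"
    using assms(1-3) p_local_domain_integers p_local_domain_localization p_local_domain_padic by blast
  let ?H = "integer_mod_group p \<times>\<times> integer_mod_group p"
  obtain h where h: "h \<in> hom G ?H" and bij: "bij_betw h (carrier G) (carrier ?H)"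
    using assms(5) by (auto simp: is_iso_def iso_def)
  have carrier_H: "carrier ?H = {0..<int p} \<times> {0..<int p}"
    using p by (simp add: DirProd_def carrier_integer_mod_group)
  define \<alpha> \<beta> where "\<alpha> g = nat (fst (h g))" and "\<beta> g = nat (snd (h g))" for g
  have mem: "fst (h g) \<in> {0..<int p} \<and> snd (h g) \<in> {0..<int p}" if "g \<in> carrier G" for g
    using bij that carrier_H by (metis bij_betwE mem_Times_iff)
  have mult: "h (g \<otimes>\<^bsub>G\<^esub> g') = ((fst (h g) + fst (h g')) mod int p, (snd (h g) + snd (h g')) mod int p)"
    if "g \<in> carrier G" "g' \<in> carrier G" for g g'
    using hom_mult[OF h that] by (simp add: DirProd_def split: prod.split)
  interpret cp_cp_lattice p K G \<alpha> \<beta> "N + 2"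
  proof (intro cp_cp_lattice.intro cp_cp_lattice_axioms.intro local assms(4))
    show "finite (carrier G)"
      using bij carrier_H by (metis bij_betw_finite finite_SigmaI finite_atLeastLessThan_int)
    show "\<alpha> g < p" "\<beta> g < p" if "g \<in> carrier G" for g
      using mem[OF that] by (auto simp: \<alpha>_def \<beta>_def)
    show "\<alpha> (g \<otimes>\<^bsub>G\<^esub> g') = (\<alpha> g + \<alpha> g') mod p" "\<beta> (g \<otimes>\<^bsub>G\<^esub> g') = (\<beta> g + \<beta> g') mod p"
      if "g \<in> carrier G" "g' \<in> carrier G" for g g'
      using mem[OF that(1)] mem[OF that(2)]
      by (simp_all add: \<alpha>_def \<beta>_def mult[OF that] nat_mod_distrib nat_add_distrib)
    show "g = g'" if g: "g \<in> carrier G" and g': "g' \<in> carrier G" and "\<alpha> g = \<alpha> g'" "\<beta> g = \<beta> g'" for g g'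
    proof -
      have "h g = h g'"
        using that mem[OF g] mem[OF g'] by (auto simp: \<alpha>_def \<beta>_def prod_eq_iff eq_nat_nat_iff)
      then show ?thesis using bij g g' by (auto simp: bij_betw_def inj_on_def)
    qed
    show "\<exists>g\<in>carrier G. \<alpha> g = a \<and> \<beta> g = b" if "a < p" "b < p" for a b
    proof -
      have "(int a, int b) \<in> h ` carrier G"
        using bij that carrier_H by (simp add: bij_betw_def)
      then obtain g where "g \<in> carrier G" "h g = (int a, int b)" by (metis imageE)
      then show ?thesis by (intro bexI[of _ g]) (simp_all add: \<alpha>_def \<beta>_def)
    qed
  qed simp
  have "lattice_rank seq_scale K lat > N" using lat_rank by simp
  then show "\<exists>(M :: (nat \<Rightarrow> 'f) set) \<rho> T.
           faithful_lattice seq_scale K G M \<rho> \<and>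
           one_cocycle seq_scale G M \<rho> T \<and>
           indecomposable_crys seq_scale K G M \<rho> T \<and>
           torsionfree (Crys G \<rho> T) \<and>
           lattice_rank seq_scale K M > N"
    using faithful_lattice_lat one_cocycle_cocycle not_coboundary indecomposable_lat torsionfree_Crys
    unfolding indecomposable_crys_def by blast
qed

end
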